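(* Let $(Z,\|\cdot\|_Z)$ and $(U,\|\cdot\|_U)$ be Banach spaces, $\mathbb{T}=[0,T]$ with $T>0$, and let $\mathfrak{A}\colon D(\mathfrak{A})\subseteq Z\to Z$ and $\mathfrak{D}\colon D(\mathfrak{D})\subseteq Z\to U$ be linear operators with $D(\mathfrak{A})\subseteq D(\mathfrak{D})$. Assume that $\mathcal{A}:=\mathfrak{A}|_{\ker\mathfrak{D}}$ is the generator of a strongly continuous semigroup $\mathcal{S}(t)$ on $Z$ and that $\mathfrak{D}$ has a linear bounded right-inverse $\mathfrak{D}_0\in\mathcal{L}(U,(D(\mathfrak{A}),\|\cdot\|_{\mathfrak{A}}))$. Let $z_0,\delta_0\in Z$ and $p\ge 1$, and assume $z_{\mathrm{b}},\delta_{\mathrm{b}}\in W^{1,p}(\mathbb{T};U)$ and $\delta\in L^p(\mathbb{T};Z)$. Let $z$ be the mild solution of $$\dot z=\mathfrak{A}z,\qquad \mathfrak{D}z=z_{\mathrm{b}},\qquad z(0)=z_0,$$ and let $\tilde z$ be the mild solution of $$\dot{\tilde z}=\mathfrak{A}\tilde z+\delta,\qquad \mathfrak{D}\tilde z=z_{\mathrm{b}}+\delta_{\mathrm{b}},\qquad \tilde z(0)=z_0+\delta_0.$$ Then there exist constants $M\ge 1$ and $\omega\in\mathbb{R}$ such that for all $t\in\mathbb{T}$ $$\|z(t)-\tilde z(t)\|_Z\le \|\mathfrak{D}_0\|_{\mathcal{L}(U,Z)}\|\delta_{\mathrm{b}}(t)\|_U+Me^{\omega t}\|\delta_0-\mathfrak{D}_0\delta_{\mathrm{b}}(0)\|_Z+\int_0^t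 Me^{\omega(t-s)}\Big(\|\mathfrak{A}\mathfrak{D}_0\|_{\mathcal{L}(U,Z)}\|\delta_{\mathrm{b}}(s)\|_U+\|\mathfrak{D}_0\|_{\mathcal{L}(U,Z)}\|\dot\delta_{\mathrm{b}}(s)\|_U+\|\delta(s)\|_Z\Big)\,\mathrm{d}s.$$
   Context: $\mathcal{L}(X,Y)$ denotes the bounded linear operators from $X$ to $Y$, and $\|\cdot\|_{\mathfrak{A}}$ is the graph norm of $\mathfrak{A}$ on $D(\mathfrak{A})$. The operator $\mathcal{A}=\mathfrak{A}|_{\ker\mathfrak{D}}$ has domain $D(\mathfrak{A})\cap\ker\mathfrak{D}$. Right-inverse means $\mathfrak{D}\mathfrak{D}_0=\mathrm{id}_U$. $L^p(\mathbb{T};X)$ is the space of $p$-Bochner-integrable functions, $W^{1,p}(\mathbb{T};X)$ the corresponding Sobolev space (functions identified with their continuous representatives), and $\dot{}$ denotes the time derivative. Mild solution: for $f\in L^p(\mathbb{T};Z)$, $g\in W^{1,p}(\mathbb{T};U)$ and $w_0\in Z$, the mild solution of $\dot w=\mathfrak{A}w+f$, $\mathfrak{D}w=g$, $w(0)=w_0$ is the function $w\colon\mathbb{T}\to Z$ given by $$w(t)=\mathfrak{D}_0 g(t)+\mathcal{S}(t)\big(w_0-\mathfrak{D}_0g(0)\big)+\int_0^t\mathcal{S}(t-s)\big(f(s)-\mathfrak{D}_0\dot g(s)+\mathfrak{A}\mathfrak{D}_0g(s)\big)\,\mathrm{d}s.$$ *)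

theory Defs
  imports "HOL-Analysis.Analysis"
begin

text \<open>Banach-space valued integration. The library's Bochner integral is restricted to
  second-countable (i.e. separable) target spaces. The following definitions lift this restriction:
  they are those of the library, with Borel measurability replaced by strong measurability and
  with the library's own notions of simple function and of the integral of a simple function,
  which are available for arbitrary target spaces.\<close>

definition strongly_measurable :: "'a measure \<Rightarrow> ('a \<Rightarrow> 'b::real_normed_vector) \<Rightarrow> bool" where
  "strongly_measurable M f \<longleftrightarrow>
    (\<exists>s. (\<forall>i::nat. simple_function M (s i)) \<and> (AE x in M. (\<lambda>i. s i x) \<longlonglongrightarrow> f x))"

definition has_bochner_int :: "'a measure \<Rightarrow> ('a \<Rightarrow> 'b::real_normed_vector) \<Rightarrow> 'b \<Rightarrow> bool" where
  "has_bochner_int M f y \<longleftrightarrow>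
    strongly_measurable M f \<and>
    (\<exists>s. (\<forall>i::nat. Bochner_Integration.simple_bochner_integrable M (s i)) \<and>
      (\<lambda>i. \<integral>\<^sup>+x. ennreal (norm (f x - s i x)) \<partial>M) \<longlonglongrightarrow> 0 \<and>
      (\<lambda>i. Bochner_Integration.simple_bochner_integral M (s i)) \<longlonglongrightarrow> y)"

definition bochner_int :: "'a measure \<Rightarrow> ('a \<Rightarrow> 'b::real_normed_vector) \<Rightarrow> 'b" where
  "bochner_int M f =
    (if \<exists>y. has_bochner_int M f y then THE y. has_bochner_int M f y else 0)"

text \<open>The spaces \<open>L\<^sup>p\<close> and \<open>W\<^sup>1\<^sup>,\<^sup>p\<close> over the interval from \<open>0\<close> to \<open>T\<close>. Their elements are functions
  on the real line of which only the restriction to that interval matters. Elements of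
  \<open>L\<^sup>p\<close> are not identified when they agree almost everywhere; elements of \<open>W\<^sup>1\<^sup>,\<^sup>p\<close>
  are the continuous representatives.\<close>

definition Lp :: "real \<Rightarrow> real \<Rightarrow> (real \<Rightarrow> 'a::banach) set" where
  "Lp p T = {f. strongly_measurable (lebesgue_on {0..T}) f \<and>
                integrable (lebesgue_on {0..T}) (\<lambda>t. norm (f t) powr p)}"

definition test_functions :: "real \<Rightarrow> (real \<Rightarrow> real) set" where
  "test_functions T = {\<phi>. (\<forall>n t. ((deriv ^^ n) \<phi>) field_differentiable (at t)) \<and>
     (\<exists>K. compact K \<and> K \<subseteq> {0<..<T} \<and> (\<forall>t. t \<notin> K \<longrightarrow> \<phi> t = 0))}"

definition has_weak_derivative ::
    "real \<Rightarrow> (real \<Rightarrow> 'a::banach) \<Rightarrow> (real \<Rightarrow> 'a) \<Rightarrow> bool" where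
  "has_weak_derivative T g h \<longleftrightarrow> g \<in> Lp 1 T \<and> h \<in> Lp 1 T \<and>
    (\<forall>\<phi>\<in>test_functions T.
       bochner_int (lebesgue_on {0..T}) (\<lambda>t. deriv \<phi> t *\<^sub>R g t) =
       - bochner_int (lebesgue_on {0..T}) (\<lambda>t. \<phi> t *\<^sub>R h t))"

definition W1p :: "real \<Rightarrow> real \<Rightarrow> (real \<Rightarrow> 'a::banach) set" where
  "W1p p T = {g. continuous_on {0..T} g \<and> g \<in> Lp p T \<and>
                 (\<exists>h\<in>Lp p T. has_weak_derivative T g h)}"

text \<open>A representative of the weak derivative, which is unique up to null sets.\<close>

definition time_deriv :: "real \<Rightarrow> (real \<Rightarrow> 'a::banach) \<Rightarrow> real \<Rightarrow> 'a" where
  "time_deriv T g = (SOME h. has_weak_derivative T g h)"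

text \<open>An unbounded operator is given by its domain \<open>X\<close> together with a total function of
  which only the values on the domain matter.\<close>

definition linear_operator ::
    "'a::real_vector set \<Rightarrow> ('a \<Rightarrow> 'b::real_vector) \<Rightarrow> bool" where
  "linear_operator X A \<longleftrightarrow> subspace X \<and>
    (\<forall>x\<in>X. \<forall>y\<in>X. A (x + y) = A x + A y) \<and>
    (\<forall>c. \<forall>x\<in>X. A (c *\<^sub>R x) = c *\<^sub>R A x)"

definition ker_op :: "'a::real_vector set \<Rightarrow> ('a \<Rightarrow> 'b::real_vector) \<Rightarrow> 'a set" where
  "ker_op X A = {x \<in> X. A x = 0}"

definition graph_norm :: "('a::real_normed_vector \<Rightarrow> 'b::real_normed_vector) \<Rightarrow> 'a \<Rightarrow> real" where
  "graph_norm A x = norm x + norm (A x)"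

definition bounded_into_graph :: "'z::real_normed_vector set \<Rightarrow> ('z \<Rightarrow> 'z) \<Rightarrow>
    ('u::real_normed_vector \<Rightarrow> 'z) \<Rightarrow> bool" where
  "bounded_into_graph X A B \<longleftrightarrow>
    linear B \<and> range B \<subseteq> X \<and> (\<exists>C. \<forall>u. graph_norm A (B u) \<le> C * norm u)"

definition C0_semigroup :: "(real \<Rightarrow> 'z::real_normed_vector \<Rightarrow>\<^sub>L 'z) \<Rightarrow> bool" where
  "C0_semigroup S \<longleftrightarrow> S 0 = id_blinfun \<and>
    (\<forall>s\<ge>0. \<forall>t\<ge>0. S (s + t) = S s o\<^sub>L S t) \<and>
    (\<forall>x. continuous_on {0..} (\<lambda>t. blinfun_apply (S t) x))"

definition is_generator ::
    "'z::real_normed_vector set \<Rightarrow> ('z \<Rightarrow> 'z) \<Rightarrow> (real \<Rightarrow> 'z \<Rightarrow>\<^sub>L 'z) \<Rightarrow> bool" where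
  "is_generator X A S \<longleftrightarrow>
    X = {x. \<exists>y. ((\<lambda>h. (1 / h) *\<^sub>R (blinfun_apply (S h) x - x)) \<longlongrightarrow> y) (at_right 0)} \<and>
    (\<forall>x\<in>X. ((\<lambda>h. (1 / h) *\<^sub>R (blinfun_apply (S h) x - x)) \<longlongrightarrow> A x) (at_right 0))"

text \<open>The mild solution of \<open>w' = A w + f\<close>, \<open>D w = g\<close>, \<open>w 0 = w0\<close>, where \<open>S\<close> is the semigroup
  generated by the restriction of \<open>A\<close> to the kernel of \<open>D\<close> and \<open>D0\<close> is a right-inverse of \<open>D\<close>.\<close>

definition mild_solution ::
    "real \<Rightarrow> (real \<Rightarrow> 'z::banach \<Rightarrow>\<^sub>L 'z) \<Rightarrow> ('z \<Rightarrow> 'z) \<Rightarrow> ('u::banach \<Rightarrow> 'z) \<Rightarrow>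
     (real \<Rightarrow> 'z) \<Rightarrow> (real \<Rightarrow> 'u) \<Rightarrow> 'z \<Rightarrow> real \<Rightarrow> 'z" where
  "mild_solution T S A D0 f g w0 t =
     D0 (g t) + blinfun_apply (S t) (w0 - D0 (g 0)) +
     bochner_int (lebesgue_on {0..t})
       (\<lambda>s. blinfun_apply (S (t - s)) (f s - D0 (time_deriv T g s) + A (D0 (g s))))"

end

theory Submission
  imports Defs
begin

text \<open>Both mild solutions are given by the variation of constants formula. Subtracting the two
  formulas, the terms with \<open>zb\<close> and \<open>z0\<close> cancel outside the integrals, and what remains is
  \<open>- D0 (\<delta>b t) - S t (\<delta>0 - D0 (\<delta>b 0))\<close> together with the difference of two convolution
  integrals. By linearity of the integral that difference is the convolution of the semigroup with
  \<open>D0 \<delta>b' - A D0 \<delta>b - \<delta>\<close>. The estimate then follows from the triangle inequality, from the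
  inequality between the norm of an integral and the integral of the norm, and from a bound
  \<open>norm (S t) \<le> M * exp (\<omega> * t)\<close>. On a compact time interval the uniform boundedness principle
  provides such a bound with \<open>\<omega> = 0\<close>.

  Two points carry the weight of the argument. First, the difference of the integrals is the
  integral of the difference only if both integrals exist. A strongly measurable function whose norm
  is dominated by an integrable function has a Bochner integral (\<open>has_bochner_int_exists\<close>), and
  \<open>s \<mapsto> S (t - s) (h s)\<close> inherits strong measurability from \<open>h\<close>
  (\<open>strongly_measurable_operator_apply\<close>); the integrals are linear (\<open>has_bochner_int_add\<close>,
  \<open>has_bochner_int_scaleR\<close>) and bounded by those of dominating functions
  (\<open>has_bochner_int_norm_bound\<close>).

  Second, the time derivative is an arbitrarily chosen representative of the weak derivative, so the
  derivative of \<open>zb + \<delta>b\<close> is the sum of the derivatives of \<open>zb\<close> and \<open>\<delta>b\<close> only up to a null set.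
  This is the uniqueness of weak derivatives, that is, the fundamental lemma of the calculus of
  variations for Banach space valued functions (\<open>AE_eq_0_if_test_integrals_0\<close>). It rests on smooth
  bump functions approximating indicators of intervals, on a Dynkin system argument, and on the fact
  that a strongly measurable function with vanishing integrals over all measurable sets is zero almost
  everywhere (\<open>AE_eq_0_if_integrals_0\<close>). The last fact compares the function with the countably many
  values of approximating simple functions.\<close>

section \<open>Strong measurability\<close>

lemma strongly_measurable_cong_AE:
  assumes "strongly_measurable M f" "AE x in M. f x = g x"
  shows "strongly_measurable M g"
proof -
  from assms obtain s where s: "\<forall>i::nat. simple_function M (s i)"
      "AE x in M. (\<lambda>i. s i x) \<longlonglongrightarrow> f x"
    unfolding strongly_measurable_def by auto
  have "AE x in M. (\<lambda>i. s i x) \<longlonglongrightarrow> g x"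
    using s(2) assms(2) by eventually_elim simp
  with s(1) show ?thesis unfolding strongly_measurable_def by auto
qed

lemma strongly_measurable_simple:
  "simple_function M f \<Longrightarrow> strongly_measurable M f"
  unfolding strongly_measurable_def by (rule exI[of _ "\<lambda>_. f"]) auto

lemma strongly_measurable_real:
  fixes f :: "'a \<Rightarrow> real"
  assumes "f \<in> borel_measurable M"
  shows "strongly_measurable M f"
proof -
  obtain s where "\<And>i. simple_function M (s i)" "\<And>x. x \<in> space M \<Longrightarrow> (\<lambda>i. s i x) \<longlonglongrightarrow> f x"
    using borel_measurable_implies_sequence_metric[OF assms, of 0] by metis
  then show ?thesis unfolding strongly_measurable_def by (intro exI[of _ s]) auto
qed

lemma strongly_measurable_compose2:
  assumes "strongly_measurable M f" "strongly_measurable M g"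
    and "continuous_on UNIV (\<lambda>(x, y). p x y)"
  shows "strongly_measurable M (\<lambda>x. p (f x) (g x))"
proof -
  from assms obtain s t where
    s: "\<forall>i::nat. simple_function M (s i)" "AE x in M. (\<lambda>i. s i x) \<longlonglongrightarrow> f x" and
    t: "\<forall>i::nat. simple_function M (t i)" "AE x in M. (\<lambda>i. t i x) \<longlonglongrightarrow> g x"
    unfolding strongly_measurable_def by auto
  have "AE x in M. (\<lambda>i. p (s i x) (t i x)) \<longlonglongrightarrow> p (f x) (g x)"
    using s(2) t(2)
  proof eventually_elim
    case (elim x)
    then have "(\<lambda>i. (s i x, t i x)) \<longlonglongrightarrow> (f x, g x)" by (rule tendsto_Pair)
    from continuous_on_tendsto_compose[OF assms(3) this] show ?case by simp
  qed
  with s(1) t(1) show ?thesis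
    unfolding strongly_measurable_def
    by (intro exI[of _ "\<lambda>i x. p (s i x) (t i x)"]) (auto intro: simple_function_compose2)
qed

lemma strongly_measurable_compose:
  assumes "strongly_measurable M f" "continuous_on UNIV p"
  shows "strongly_measurable M (\<lambda>x. p (f x))"
  using strongly_measurable_compose2[OF assms(1) assms(1), of "\<lambda>x y. p x"] assms(2)
  by (simp add: case_prod_unfold continuous_on_compose2[OF assms(2)] continuous_on_fst)

lemma strongly_measurable_add:
  "strongly_measurable M f \<Longrightarrow> strongly_measurable M g \<Longrightarrow> strongly_measurable M (\<lambda>x. f x + g x)"
  by (rule strongly_measurable_compose2) (auto simp: case_prod_unfold intro!: continuous_intros)

lemma strongly_measurable_scaleR:
  fixes f :: "'a \<Rightarrow> real"
  shows "f \<in> borel_measurable M \<Longrightarrow> strongly_measurable M g \<Longrightarrow> strongly_measurable M (\<lambda>x. f x *\<^sub>R g x)"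
  by (rule strongly_measurable_compose2[OF strongly_measurable_real])
    (auto simp: case_prod_unfold intro!: continuous_intros)

text \<open>Setting the function to zero on a measurable null set makes the simple functions converge
  everywhere. The modified function has Borel measurable distances to simple functions, which the
  given one need not have when the measure is incomplete.\<close>

lemma strongly_measurable_representative:
  assumes "strongly_measurable M f"
  obtains s g where "\<And>i::nat. simple_function M (s i)" "\<And>x. (\<lambda>i. s i x) \<longlonglongrightarrow> g x"
    "AE x in M. f x = g x"
proof -
  from assms obtain s where s: "\<And>i::nat. simple_function M (s i)"
      "AE x in M. (\<lambda>i. s i x) \<longlonglongrightarrow> f x"
    unfolding strongly_measurable_def by auto
  from AE_E[OF s(2)] obtain N where N: "{x \<in> space M. \<not> (\<lambda>i. s i x) \<longlonglongrightarrow> f x} \<subseteq> N"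
    "emeasure M N = 0" "N \<in> sets M" by blast
  define s' where "s' i x = (if x \<in> space M - N then s i x else 0)" for i x
  define g where "g x = (if x \<in> space M - N then f x else 0)" for x
  show thesis
  proof
    show "simple_function M (s' i)" for i
      unfolding s'_def using s(1) N(3) by (intro simple_function_If_set) auto
    show "(\<lambda>i. s' i x) \<longlonglongrightarrow> g x" for x
      using N(1) by (auto simp: s'_def g_def)
    have "AE x in M. x \<notin> N"
      using N(2,3) by (intro AE_not_in) auto
    then show "AE x in M. f x = g x"
      using AE_space by eventually_elim (auto simp: g_def)
  qed
qed

lemma borel_measurable_norm_limit_diff:
  assumes s: "\<And>i::nat. simple_function M (s i)" and lim: "\<And>x. (\<lambda>i. s i x) \<longlonglongrightarrow> (g x :: 'b::real_normed_vector)"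
    and t: "simple_function M t"
  shows "(\<lambda>x. norm (g x - t x)) \<in> borel_measurable M"
proof (rule borel_measurable_LIMSEQ_real)
  show "(\<lambda>x. norm (s i x - t x)) \<in> borel_measurable M" for i
    by (intro borel_measurable_simple_function simple_function_compose2[OF s t, of "\<lambda>x y. norm (x - y)"])
  show "(\<lambda>i. norm (s i x - t x)) \<longlonglongrightarrow> norm (g x - t x)" for x
    by (intro tendsto_intros lim)
qed

lemma strongly_measurable_norm_diff_representative:
  assumes "strongly_measurable M f"
  obtains g where "AE x in M. f x = g x"
    "\<And>t. simple_function M t \<Longrightarrow> (\<lambda>x. norm (g x - t x)) \<in> borel_measurable M"
  by (rule strongly_measurable_representative[OF assms])
    (blast intro: borel_measurable_norm_limit_diff)

text \<open>Additivity of the nonnegative integral requires measurable integrands; it is obtained here by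
  passing to the representative with Borel measurable distances to simple functions.\<close>

lemma nn_integral_add_norm_diff:
  assumes f: "strongly_measurable M f" and s: "simple_function M s" and w: "v \<in> borel_measurable M"
  shows "(\<integral>\<^sup>+x. ennreal (norm (f x - s x)) + v x \<partial>M) =
    (\<integral>\<^sup>+x. ennreal (norm (f x - s x)) \<partial>M) + (\<integral>\<^sup>+x. v x \<partial>M)"
proof -
  obtain g where g: "AE x in M. f x = g x" "(\<lambda>x. norm (g x - s x)) \<in> borel_measurable M"
    using strongly_measurable_norm_diff_representative[OF f] s by metis
  have "(\<integral>\<^sup>+x. ennreal (norm (f x - s x)) + v x \<partial>M) = (\<integral>\<^sup>+x. ennreal (norm (g x - s x)) + v x \<partial>M)"
    by (intro nn_integral_cong_AE) (use g(1) in eventually_elim, simp)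
  also have "\<dots> = (\<integral>\<^sup>+x. ennreal (norm (g x - s x)) \<partial>M) + (\<integral>\<^sup>+x. v x \<partial>M)"
    using g(2) w by (intro nn_integral_add) auto
  also have "(\<integral>\<^sup>+x. ennreal (norm (g x - s x)) \<partial>M) = (\<integral>\<^sup>+x. ennreal (norm (f x - s x)) \<partial>M)"
    by (intro nn_integral_cong_AE) (use g(1) in eventually_elim, simp)
  finally show ?thesis .
qed

lemma nn_integral_add_norm_diffs:
  assumes f: "strongly_measurable M f" and s: "simple_function M s"
    and g: "strongly_measurable M g" and t: "simple_function M t"
  shows "(\<integral>\<^sup>+x. ennreal (norm (f x - s x)) + ennreal (norm (g x - t x)) \<partial>M) =
    (\<integral>\<^sup>+x. ennreal (norm (f x - s x)) \<partial>M) + (\<integral>\<^sup>+x. ennreal (norm (g x - t x)) \<partial>M)"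
proof -
  obtain h where h: "AE x in M. g x = h x" "(\<lambda>x. norm (h x - t x)) \<in> borel_measurable M"
    using strongly_measurable_norm_diff_representative[OF g] t by metis
  have "(\<integral>\<^sup>+x. ennreal (norm (f x - s x)) + ennreal (norm (g x - t x)) \<partial>M) =
     (\<integral>\<^sup>+x. ennreal (norm (f x - s x)) + ennreal (norm (h x - t x)) \<partial>M)"
    by (intro nn_integral_cong_AE) (use h(1) in eventually_elim, simp)
  also have "\<dots> = (\<integral>\<^sup>+x. ennreal (norm (f x - s x)) \<partial>M) + (\<integral>\<^sup>+x. ennreal (norm (h x - t x)) \<partial>M)"
    using h(2) by (intro nn_integral_add_norm_diff f s) auto
  also have "(\<integral>\<^sup>+x. ennreal (norm (h x - t x)) \<partial>M) = (\<integral>\<^sup>+x. ennreal (norm (g x - t x)) \<partial>M)"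
    by (intro nn_integral_cong_AE) (use h(1) in eventually_elim, simp)
  finally show ?thesis .
qed

section \<open>The Bochner integral\<close>

abbreviation (input) "sb_integrable \<equiv> Bochner_Integration.simple_bochner_integrable"
abbreviation (input) "sb_integral \<equiv> Bochner_Integration.simple_bochner_integral"

lemma sb_integrable_simple: "sb_integrable M s \<Longrightarrow> simple_function M s"
  by (auto elim: simple_bochner_integrable.cases)

lemma norm_sb_integral_le:
  assumes "sb_integrable M s"
  shows "ennreal (norm (sb_integral M s)) \<le> (\<integral>\<^sup>+x. ennreal (norm (s x)) \<partial>M)"
proof -
  have "sb_integrable M (\<lambda>x. norm (s x))"
    using simple_bochner_integrable_compose2[of "\<lambda>x y. norm x", OF _ assms assms] by simp
  then have "ennreal (sb_integral M (\<lambda>x. norm (s x))) = (\<integral>\<^sup>+x. ennreal (norm (s x)) \<partial>M)"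
    by (intro simple_bochner_integral_eq_nn_integral) auto
  moreover have "ennreal (norm (sb_integral M s)) \<le> ennreal (sb_integral M (\<lambda>x. norm (s x)))"
    by (intro ennreal_leI simple_bochner_integral_norm_bound assms)
  ultimately show ?thesis by simp
qed

lemma sb_integral_diff_bound:
  assumes f: "strongly_measurable M f" and s: "sb_integrable M s" and t: "sb_integrable M t"
  shows "ennreal (norm (sb_integral M s - sb_integral M t)) \<le>
    (\<integral>\<^sup>+x. ennreal (norm (f x - s x)) \<partial>M) + (\<integral>\<^sup>+x. ennreal (norm (f x - t x)) \<partial>M)"
proof -
  have "ennreal (norm (sb_integral M s - sb_integral M t)) = norm (sb_integral M (\<lambda>x. s x - t x))"
    using s t by (simp add: simple_bochner_integral_diff)
  also have "\<dots> \<le> (\<integral>\<^sup>+x. ennreal (norm (s x - t x)) \<partial>M)"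
    using simple_bochner_integrable_compose2[of "(-)" M s t] s t
    by (intro norm_sb_integral_le) auto
  also have "\<dots> \<le> (\<integral>\<^sup>+x. ennreal (norm (f x - s x)) + ennreal (norm (f x - t x)) \<partial>M)"
  proof (intro nn_integral_mono)
    fix x
    have "norm (s x - t x) \<le> norm (f x - s x) + norm (f x - t x)"
      by (metis norm_minus_commute norm_diff_triangle_le order_refl)
    then show "ennreal (norm (s x - t x)) \<le> ennreal (norm (f x - s x)) + ennreal (norm (f x - t x))"
      by (simp flip: ennreal_plus)
  qed
  also have "\<dots> = (\<integral>\<^sup>+x. ennreal (norm (f x - s x)) \<partial>M) + (\<integral>\<^sup>+x. ennreal (norm (f x - t x)) \<partial>M)"
    using s t f by (intro nn_integral_add_norm_diffs sb_integrable_simple)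
  finally show ?thesis .
qed

text \<open>Two approximating sequences for the same function have integrals that approach each other.\<close>

lemma has_bochner_int_unique:
  assumes "has_bochner_int M f a" "has_bochner_int M f b"
  shows "a = b"
proof -
  from assms obtain s t where f: "strongly_measurable M f"
    and s: "\<And>i::nat. sb_integrable M (s i)" "(\<lambda>i. \<integral>\<^sup>+x. ennreal (norm (f x - s i x)) \<partial>M) \<longlonglongrightarrow> 0"
      "(\<lambda>i. sb_integral M (s i)) \<longlonglongrightarrow> a"
    and t: "\<And>i::nat. sb_integrable M (t i)" "(\<lambda>i. \<integral>\<^sup>+x. ennreal (norm (f x - t i x)) \<partial>M) \<longlonglongrightarrow> 0"
      "(\<lambda>i. sb_integral M (t i)) \<longlonglongrightarrow> b"
    unfolding has_bochner_int_def by blast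
  have "(\<lambda>i. ennreal (norm (sb_integral M (s i) - sb_integral M (t i)))) \<longlonglongrightarrow> ennreal (norm (a - b))"
    by (intro tendsto_ennrealI tendsto_norm tendsto_diff s t)
  moreover have "(\<lambda>i. ennreal (norm (sb_integral M (s i) - sb_integral M (t i)))) \<longlonglongrightarrow> 0"
  proof (rule tendsto_sandwich[OF _ _ tendsto_const])
    show "(\<lambda>i. (\<integral>\<^sup>+x. ennreal (norm (f x - s i x)) \<partial>M) + (\<integral>\<^sup>+x. ennreal (norm (f x - t i x)) \<partial>M)) \<longlonglongrightarrow> 0"
      using tendsto_add[OF s(2) t(2)] by simp
  qed (auto intro!: always_eventually sb_integral_diff_bound f s t)
  ultimately have "ennreal (norm (a - b)) = 0"
    using LIMSEQ_unique by blast
  then show ?thesis by simp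
qed

lemma bochner_int_eqI: "has_bochner_int M f a \<Longrightarrow> bochner_int M f = a"
  unfolding bochner_int_def using has_bochner_int_unique by (auto intro!: the_equality)

lemma has_bochner_int_cong_AE:
  assumes f: "has_bochner_int M f a" and eq: "AE x in M. f x = g x"
  shows "has_bochner_int M g a"
proof -
  have "(\<integral>\<^sup>+x. ennreal (norm (f x - t x)) \<partial>M) = (\<integral>\<^sup>+x. ennreal (norm (g x - t x)) \<partial>M)" for t
    by (intro nn_integral_cong_AE) (use eq in eventually_elim, simp)
  with f strongly_measurable_cong_AE[OF _ eq] show ?thesis
    unfolding has_bochner_int_def by auto
qed

lemma has_bochner_int_add:
  assumes "has_bochner_int M f a" "has_bochner_int M g b"
  shows "has_bochner_int M (\<lambda>x. f x + g x) (a + b)"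
proof -
  from assms obtain s t where f: "strongly_measurable M f" and g: "strongly_measurable M g"
    and s: "\<And>i::nat. sb_integrable M (s i)" "(\<lambda>i. \<integral>\<^sup>+x. ennreal (norm (f x - s i x)) \<partial>M) \<longlonglongrightarrow> 0"
      "(\<lambda>i. sb_integral M (s i)) \<longlonglongrightarrow> a"
    and t: "\<And>i::nat. sb_integrable M (t i)" "(\<lambda>i. \<integral>\<^sup>+x. ennreal (norm (g x - t i x)) \<partial>M) \<longlonglongrightarrow> 0"
      "(\<lambda>i. sb_integral M (t i)) \<longlonglongrightarrow> b"
    unfolding has_bochner_int_def by blast
  have "(\<lambda>i. \<integral>\<^sup>+x. ennreal (norm (f x + g x - (s i x + t i x))) \<partial>M) \<longlonglongrightarrow> 0"
  proof (rule tendsto_sandwich[OF _ _ tendsto_const])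
    show "(\<lambda>i. (\<integral>\<^sup>+x. ennreal (norm (f x - s i x)) \<partial>M) + (\<integral>\<^sup>+x. ennreal (norm (g x - t i x)) \<partial>M)) \<longlonglongrightarrow> 0"
      using tendsto_add[OF s(2) t(2)] by simp
    have "(\<integral>\<^sup>+x. ennreal (norm (f x + g x - (s i x + t i x))) \<partial>M) \<le>
        (\<integral>\<^sup>+x. ennreal (norm (f x - s i x)) + ennreal (norm (g x - t i x)) \<partial>M)" for i
      by (intro nn_integral_mono) (simp add: norm_diff_triangle_ineq flip: ennreal_plus)
    then show "\<forall>\<^sub>F i in sequentially. (\<integral>\<^sup>+x. ennreal (norm (f x + g x - (s i x + t i x))) \<partial>M) \<le>
      (\<integral>\<^sup>+x. ennreal (norm (f x - s i x)) \<partial>M) + (\<integral>\<^sup>+x. ennreal (norm (g x - t i x)) \<partial>M)"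
      by (simp add: nn_integral_add_norm_diffs f g s(1) t(1) sb_integrable_simple)
  qed auto
  moreover have "sb_integrable M (\<lambda>x. s i x + t i x)" for i
    using simple_bochner_integrable_compose2[of "(+)", OF _ s(1) t(1)] by simp
  moreover have "(\<lambda>i. sb_integral M (\<lambda>x. s i x + t i x)) \<longlonglongrightarrow> a + b"
    using tendsto_add[OF s(3) t(3)] by (simp add: simple_bochner_integral_add s(1) t(1))
  ultimately show ?thesis
    unfolding has_bochner_int_def using strongly_measurable_add[OF f g]
    by (intro conjI exI[of _ "\<lambda>i x. s i x + t i x"]) auto
qed

lemma has_bochner_int_scaleR:
  assumes "has_bochner_int M f a"
  shows "has_bochner_int M (\<lambda>x. c *\<^sub>R f x) (c *\<^sub>R a)"
proof -
  from assms obtain s where f: "strongly_measurable M f"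
    and s: "\<And>i::nat. sb_integrable M (s i)" "(\<lambda>i. \<integral>\<^sup>+x. ennreal (norm (f x - s i x)) \<partial>M) \<longlonglongrightarrow> 0"
      "(\<lambda>i. sb_integral M (s i)) \<longlonglongrightarrow> a"
    unfolding has_bochner_int_def by blast
  obtain g where g: "AE x in M. f x = g x"
      "\<And>t. simple_function M t \<Longrightarrow> (\<lambda>x. norm (g x - t x)) \<in> borel_measurable M"
    using strongly_measurable_norm_diff_representative[OF f] by metis
  have "(\<integral>\<^sup>+x. ennreal (norm (c *\<^sub>R f x - c *\<^sub>R s i x)) \<partial>M) =
      ennreal \<bar>c\<bar> * (\<integral>\<^sup>+x. ennreal (norm (f x - s i x)) \<partial>M)" for i
  proof -
    have "(\<integral>\<^sup>+x. ennreal (norm (c *\<^sub>R f x - c *\<^sub>R s i x)) \<partial>M) =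
        (\<integral>\<^sup>+x. ennreal \<bar>c\<bar> * ennreal (norm (g x - s i x)) \<partial>M)"
      by (intro nn_integral_cong_AE)
        (use g(1) in eventually_elim, simp add: ennreal_mult flip: scaleR_diff_right)
    also have "\<dots> = ennreal \<bar>c\<bar> * (\<integral>\<^sup>+x. ennreal (norm (g x - s i x)) \<partial>M)"
      using g(2)[OF sb_integrable_simple[OF s(1)]] by (intro nn_integral_cmult) auto
    also have "(\<integral>\<^sup>+x. ennreal (norm (g x - s i x)) \<partial>M) = (\<integral>\<^sup>+x. ennreal (norm (f x - s i x)) \<partial>M)"
      by (intro nn_integral_cong_AE) (use g(1) in eventually_elim, simp)
    finally show ?thesis .
  qed
  then have "(\<lambda>i. \<integral>\<^sup>+x. ennreal (norm (c *\<^sub>R f x - c *\<^sub>R s i x)) \<partial>M) \<longlonglongrightarrow> 0"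
    using ennreal_tendsto_cmult[OF _ s(2), of "ennreal \<bar>c\<bar>"] by simp
  moreover have "sb_integrable M (\<lambda>x. c *\<^sub>R s i x)" for i
    using simple_bochner_integrable_compose2[of "\<lambda>x y. c *\<^sub>R x", OF _ s(1) s(1)] by simp
  moreover have "(\<lambda>i. sb_integral M (\<lambda>x. c *\<^sub>R s i x)) \<longlonglongrightarrow> c *\<^sub>R a"
    using tendsto_scaleR[OF tendsto_const s(3), of c]
    by (simp add: simple_bochner_integral_linear[OF linear_scale_self s(1)])
  moreover have "strongly_measurable M (\<lambda>x. c *\<^sub>R f x)"
    by (intro strongly_measurable_scaleR f) auto
  ultimately show ?thesis
    unfolding has_bochner_int_def by (intro conjI exI[of _ "\<lambda>i x. c *\<^sub>R s i x"]) auto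
qed

lemma has_bochner_int_diff:
  assumes "has_bochner_int M f a" "has_bochner_int M g b"
  shows "has_bochner_int M (\<lambda>x. f x - g x) (a - b)"
  using has_bochner_int_add[OF assms(1) has_bochner_int_scaleR[OF assms(2), of "-1"]] by simp

lemma has_bochner_int_simple:
  assumes "sb_integrable M s"
  shows "has_bochner_int M s (sb_integral M s)"
  unfolding has_bochner_int_def
  using assms by (auto intro!: exI[of _ "\<lambda>_. s"] strongly_measurable_simple sb_integrable_simple)

lemma has_bochner_int_indicator:
  assumes "finite_measure M" "E \<in> sets M"
  shows "has_bochner_int M (\<lambda>x. indicator E x *\<^sub>R c) (measure M E *\<^sub>R c)"
proof -
  interpret finite_measure M by fact
  have sb: "sb_integrable M (indicator E :: _ \<Rightarrow> real)"
    using assms(2) by (intro simple_bochner_integrable.intros simple_function_indicator) auto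
  have "ennreal (sb_integral M (indicator E)) = (\<integral>\<^sup>+x. ennreal (indicator E x) \<partial>M)"
    by (intro simple_bochner_integral_eq_nn_integral sb) auto
  also have "\<dots> = ennreal (measure M E)"
    using assms(2) by (simp add: ennreal_indicator emeasure_eq_measure)
  finally have "sb_integral M (indicator E) = measure M E"
    by (simp add: ennreal_inj simple_bochner_integral_nonneg)
  moreover have "sb_integral M (\<lambda>x. indicator E x *\<^sub>R c) = sb_integral M (indicator E) *\<^sub>R c"
    by (rule simple_bochner_integral_linear[OF _ sb]) (auto intro!: linearI simp: scaleR_add_left)
  moreover have "sb_integrable M (\<lambda>x. indicator E x *\<^sub>R c)"
    using simple_bochner_integrable_compose2[of "\<lambda>x y. x *\<^sub>R c", OF _ sb sb] by simp
  ultimately show ?thesis using has_bochner_int_simple by fastforce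
qed

text \<open>The dominating function \<open>w\<close> stands in for the norm of \<open>f\<close>, which is Borel measurable only
  up to a null set.\<close>

lemma has_bochner_int_norm_bound:
  assumes "has_bochner_int M f a" and w: "integrable M w" and bd: "AE x in M. norm (f x) \<le> w x"
  shows "norm a \<le> (\<integral>x. w x \<partial>M)"
proof -
  from assms obtain s where f: "strongly_measurable M f"
    and s: "\<And>i::nat. sb_integrable M (s i)" "(\<lambda>i. \<integral>\<^sup>+x. ennreal (norm (f x - s i x)) \<partial>M) \<longlonglongrightarrow> 0"
      "(\<lambda>i. sb_integral M (s i)) \<longlonglongrightarrow> a"
    unfolding has_bochner_int_def by blast
  have w0: "AE x in M. 0 \<le> w x"
    using bd by eventually_elim (meson norm_ge_zero order_trans)
  have "ennreal (norm (sb_integral M (s i))) \<le>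
      (\<integral>\<^sup>+x. ennreal (norm (f x - s i x)) \<partial>M) + (\<integral>\<^sup>+x. ennreal (w x) \<partial>M)" for i
  proof -
    have "ennreal (norm (sb_integral M (s i))) \<le> (\<integral>\<^sup>+x. ennreal (norm (s i x)) \<partial>M)"
      by (rule norm_sb_integral_le[OF s(1)])
    also have "\<dots> \<le> (\<integral>\<^sup>+x. ennreal (norm (f x - s i x)) + ennreal (w x) \<partial>M)"
    proof (rule nn_integral_mono_AE, use bd w0 in eventually_elim)
      case (elim x)
      then have "norm (s i x) \<le> norm (f x - s i x) + w x"
        using norm_triangle_sub[of "s i x" "f x"] by (simp add: norm_minus_commute)
      then show ?case using elim by (simp flip: ennreal_plus)
    qed
    also have "\<dots> = (\<integral>\<^sup>+x. ennreal (norm (f x - s i x)) \<partial>M) + (\<integral>\<^sup>+x. ennreal (w x) \<partial>M)"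
      using w by (intro nn_integral_add_norm_diff f sb_integrable_simple s(1)) auto
    finally show ?thesis .
  qed
  moreover have "(\<lambda>i. ennreal (norm (sb_integral M (s i)))) \<longlonglongrightarrow> ennreal (norm a)"
    by (intro tendsto_ennrealI tendsto_norm s)
  moreover have "(\<lambda>i. (\<integral>\<^sup>+x. ennreal (norm (f x - s i x)) \<partial>M) + (\<integral>\<^sup>+x. ennreal (w x) \<partial>M))
      \<longlonglongrightarrow> 0 + (\<integral>\<^sup>+x. ennreal (w x) \<partial>M)"
    by (intro tendsto_intros s)
  ultimately have "ennreal (norm a) \<le> 0 + (\<integral>\<^sup>+x. ennreal (w x) \<partial>M)"
    by (meson LIMSEQ_le)
  also have "\<dots> = ennreal (\<integral>x. w x \<partial>M)"
    using nn_integral_eq_integral[OF w w0] by simp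
  finally show ?thesis
    using integral_nonneg_AE[OF w0] by simp
qed

text \<open>Discarding the values of the approximating simple functions that exceed twice the norm of the
  limit keeps the pointwise convergence and makes them dominated. Dominated convergence then gives
  convergence in mean, and the integrals form a Cauchy sequence.\<close>

lemma has_bochner_int_exists:
  fixes f :: "'a \<Rightarrow> 'b::banach"
  assumes f: "strongly_measurable M f" and w: "integrable M w" and bd: "AE x in M. norm (f x) \<le> w x"
  obtains a where "has_bochner_int M f a"
proof -
  obtain s g where s: "\<And>i::nat. simple_function M (s i)" "\<And>x. (\<lambda>i. s i x) \<longlonglongrightarrow> g x"
    and fg: "AE x in M. f x = g x"
    using strongly_measurable_representative[OF f] by metis
  have gm[measurable]: "(\<lambda>x. norm (g x)) \<in> borel_measurable M"
    using borel_measurable_norm_limit_diff[OF s, of "\<lambda>_. 0"] by simp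
  have sm[measurable]: "(\<lambda>x. norm (s i x)) \<in> borel_measurable M" for i
    by (intro borel_measurable_simple_function simple_function_compose1[OF s(1)])
  define t where "t i x = (if norm (s i x) \<le> 2 * norm (g x) then s i x else 0)" for i x
  have t: "simple_function M (t i)" for i
    unfolding t_def using s(1) by (intro simple_function_If) auto
  have tlim: "(\<lambda>i. t i x) \<longlonglongrightarrow> g x" for x
  proof (cases "g x = 0")
    case True then show ?thesis by (simp add: t_def if_distrib cong: if_cong)
  next
    case False
    then have "norm (g x) < 2 * norm (g x)" by simp
    from order_tendstoD(2)[OF tendsto_norm[OF s(2)] this]
    have "\<forall>\<^sub>F i in sequentially. s i x = t i x"
      by eventually_elim (simp add: t_def)
    from Lim_transform_eventually[OF s(2) this] show ?thesis .
  qed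
  have tb: "norm (t i x) \<le> 2 * norm (g x)" for i x
    by (simp add: t_def)
  have gw: "AE x in M. norm (g x) \<le> w x"
    using bd fg by eventually_elim simp
  have "integrable M (\<lambda>x. norm (g x))"
    by (rule Bochner_Integration.integrable_bound[OF w gm]) (use gw in eventually_elim, simp)
  then have fin: "(\<integral>\<^sup>+x. ennreal (norm (g x)) \<partial>M) < \<infinity>"
    by (simp add: integrable_iff_bounded)
  have fin3: "(\<integral>\<^sup>+x. ennreal (c * norm (g x)) \<partial>M) < \<infinity>" if "c \<ge> 0" for c
    using fin that by (simp add: ennreal_mult nn_integral_cmult ennreal_mult_less_top)
  have sb: "sb_integrable M (t i)" for i
  proof (rule simple_bochner_integrableI_bounded[OF t])
    have "(\<integral>\<^sup>+x. ennreal (norm (t i x)) \<partial>M) \<le> (\<integral>\<^sup>+x. ennreal (2 * norm (g x)) \<partial>M)"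
      by (intro nn_integral_mono ennreal_leI tb)
    then show "(\<integral>\<^sup>+x. ennreal (norm (t i x)) \<partial>M) < \<infinity>" using fin3[of 2] by simp
  qed
  have "(\<lambda>i. \<integral>\<^sup>+x. ennreal (norm (g x - t i x)) \<partial>M) \<longlonglongrightarrow> (\<integral>\<^sup>+x. 0 \<partial>M)"
  proof (rule nn_integral_dominated_convergence)
    show "(\<lambda>x. ennreal (norm (g x - t i x))) \<in> borel_measurable M" for i
      using borel_measurable_norm_limit_diff[OF s t[of i]] by simp
    show "(\<lambda>x. ennreal (3 * norm (g x))) \<in> borel_measurable M" by simp
    show "(\<integral>\<^sup>+x. ennreal (3 * norm (g x)) \<partial>M) < \<infinity>" using fin3[of 3] by simp
    show "AE x in M. ennreal (norm (g x - t i x)) \<le> ennreal (3 * norm (g x))" for i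
    proof (rule AE_I2, rule ennreal_leI)
      fix x show "norm (g x - t i x) \<le> 3 * norm (g x)"
        using norm_triangle_ineq4[of "g x" "t i x"] tb[of i x] by linarith
    qed
    show "AE x in M. (\<lambda>i. ennreal (norm (g x - t i x))) \<longlonglongrightarrow> 0"
    proof (rule AE_I2)
      fix x
      have "(\<lambda>i. norm (g x - t i x)) \<longlonglongrightarrow> norm (g x - g x)"
        by (intro tendsto_intros tlim)
      from tendsto_ennrealI[OF this] show "(\<lambda>i. ennreal (norm (g x - t i x))) \<longlonglongrightarrow> 0" by simp
    qed
  qed auto
  moreover have "(\<integral>\<^sup>+x. ennreal (norm (g x - t i x)) \<partial>M) = (\<integral>\<^sup>+x. ennreal (norm (f x - t i x)) \<partial>M)" for i
    by (intro nn_integral_cong_AE) (use fg in eventually_elim, simp)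
  ultimately have conv: "(\<lambda>i. \<integral>\<^sup>+x. ennreal (norm (f x - t i x)) \<partial>M) \<longlonglongrightarrow> 0"
    by simp
  have "Cauchy (\<lambda>i. sb_integral M (t i))"
  proof (rule metric_CauchyI)
    fix e :: real assume e: "e > 0"
    then have "\<forall>\<^sub>F i in sequentially. (\<integral>\<^sup>+x. ennreal (norm (f x - t i x)) \<partial>M) < ennreal (e / 2)"
      by (intro order_tendstoD(2)[OF conv]) simp
    then obtain N where N: "\<And>i. i \<ge> N \<Longrightarrow> (\<integral>\<^sup>+x. ennreal (norm (f x - t i x)) \<partial>M) < ennreal (e / 2)"
      by (auto simp: eventually_sequentially)
    have "dist (sb_integral M (t m)) (sb_integral M (t n)) < e" if "m \<ge> N" "n \<ge> N" for m n
    proof -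
      have "ennreal (norm (sb_integral M (t m) - sb_integral M (t n))) < ennreal (e / 2) + ennreal (e / 2)"
        using sb_integral_diff_bound[OF f sb[of m] sb[of n]] add_strict_mono[OF N[OF that(1)] N[OF that(2)]]
        by (rule order.strict_trans1)
      also have "\<dots> = ennreal e" using e by (simp flip: ennreal_plus)
      finally show ?thesis using e by (simp add: dist_norm ennreal_less_iff)
    qed
    then show "\<exists>N. \<forall>m\<ge>N. \<forall>n\<ge>N. dist (sb_integral M (t m)) (sb_integral M (t n)) < e" by blast
  qed
  then obtain a where "(\<lambda>i. sb_integral M (t i)) \<longlonglongrightarrow> a"
    by (auto simp: Cauchy_convergent_iff convergent_def)
  with conv sb f have "has_bochner_int M f a"
    unfolding has_bochner_int_def by blast
  then show thesis by (rule that)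
qed

text \<open>The norm bound reduces this to the dominated convergence theorem for the real functions
  \<open>\<bar>\<psi> - \<phi> n\<bar> * norm f\<close>.\<close>

lemma has_bochner_int_dominated_limit:
  fixes f :: "'a \<Rightarrow> 'b::banach"
  assumes \<phi>: "\<And>n::nat. \<phi> n \<in> borel_measurable M" "\<And>n x. \<bar>\<phi> n x\<bar> \<le> 1" "\<And>x. (\<lambda>n. \<phi> n x) \<longlonglongrightarrow> \<psi> x"
    and \<psi>: "\<psi> \<in> borel_measurable M"
    and f: "strongly_measurable M f" "integrable M (\<lambda>x. norm (f x))"
    and int: "\<And>n. has_bochner_int M (\<lambda>x. \<phi> n x *\<^sub>R f x) a"
  shows "has_bochner_int M (\<lambda>x. \<psi> x *\<^sub>R f x) a"
proof -
  have \<psi>1: "\<bar>\<psi> x\<bar> \<le> 1" for x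
    by (rule LIMSEQ_le_const2[OF tendsto_rabs[OF \<phi>(3)]]) (auto simp: \<phi>(2))
  have "strongly_measurable M (\<lambda>x. \<psi> x *\<^sub>R f x)"
    by (intro strongly_measurable_scaleR \<psi> f)
  moreover have "AE x in M. norm (\<psi> x *\<^sub>R f x) \<le> norm (f x)"
    by (rule AE_I2) (auto intro!: mult_left_le_one_le \<psi>1)
  ultimately obtain b where b: "has_bochner_int M (\<lambda>x. \<psi> x *\<^sub>R f x) b"
    using f(2) has_bochner_int_exists by blast
  have lim: "(\<lambda>n. \<integral>x. \<bar>\<psi> x - \<phi> n x\<bar> * norm (f x) \<partial>M) \<longlonglongrightarrow> (\<integral>x. 0 \<partial>M)"
  proof (rule integral_dominated_convergence)
    show "integrable M (\<lambda>x. 2 * norm (f x))" using f(2) by simp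
    show "(\<lambda>x. \<bar>\<psi> x - \<phi> n x\<bar> * norm (f x)) \<in> borel_measurable M" for n
      using f(2) \<phi>(1) \<psi> by (intro borel_measurable_times borel_measurable_abs borel_measurable_diff) auto
    show "AE x in M. (\<lambda>n. \<bar>\<psi> x - \<phi> n x\<bar> * norm (f x)) \<longlonglongrightarrow> 0"
    proof (rule AE_I2)
      fix x
      have "(\<lambda>n. \<bar>\<psi> x - \<phi> n x\<bar> * norm (f x)) \<longlonglongrightarrow> \<bar>\<psi> x - \<psi> x\<bar> * norm (f x)"
        by (intro tendsto_intros \<phi>(3))
      then show "(\<lambda>n. \<bar>\<psi> x - \<phi> n x\<bar> * norm (f x)) \<longlonglongrightarrow> 0" by simp
    qed
    show "AE x in M. norm (\<bar>\<psi> x - \<phi> n x\<bar> * norm (f x)) \<le> 2 * norm (f x)" for n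
    proof (rule AE_I2)
      fix x
      have "\<bar>\<psi> x - \<phi> n x\<bar> \<le> 2" using \<psi>1[of x] \<phi>(2)[of n x] by linarith
      then show "norm (\<bar>\<psi> x - \<phi> n x\<bar> * norm (f x)) \<le> 2 * norm (f x)"
        by (simp add: mult_right_mono)
    qed
  qed simp
  have "norm (b - a) \<le> (\<integral>x. \<bar>\<psi> x - \<phi> n x\<bar> * norm (f x) \<partial>M)" for n
  proof (rule has_bochner_int_norm_bound[OF has_bochner_int_diff[OF b int[of n]]])
    show "integrable M (\<lambda>x. \<bar>\<psi> x - \<phi> n x\<bar> * norm (f x))"
    proof (rule Bochner_Integration.integrable_bound)
      show "integrable M (\<lambda>x. 2 * norm (f x))" using f(2) by simp
      show "(\<lambda>x. \<bar>\<psi> x - \<phi> n x\<bar> * norm (f x)) \<in> borel_measurable M"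
        using f(2) \<phi>(1) \<psi> by (intro borel_measurable_times borel_measurable_abs borel_measurable_diff) auto
      show "AE x in M. norm (\<bar>\<psi> x - \<phi> n x\<bar> * norm (f x)) \<le> norm (2 * norm (f x))"
      proof (rule AE_I2)
        fix x
        have "\<bar>\<psi> x - \<phi> n x\<bar> \<le> 2" using \<psi>1[of x] \<phi>(2)[of n x] by linarith
        then show "norm (\<bar>\<psi> x - \<phi> n x\<bar> * norm (f x)) \<le> norm (2 * norm (f x))"
          by (simp add: mult_right_mono)
      qed
    qed
    show "AE x in M. norm (\<psi> x *\<^sub>R f x - \<phi> n x *\<^sub>R f x) \<le> \<bar>\<psi> x - \<phi> n x\<bar> * norm (f x)"
      by (rule AE_I2) (simp flip: scaleR_diff_left)
  qed
  then have "norm (b - a) \<le> (\<integral>x. 0 \<partial>M)"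
    by (intro LIMSEQ_le_const[OF lim]) auto
  then show ?thesis using b by simp
qed

text \<open>The values \<open>c\<close> of the approximating simple functions form a countable set. Where the limit is
  closer to \<open>c\<close> than \<open>norm c / 2\<close>, the vanishing integral differs from that of the constant \<open>c\<close> by at
  most half the norm of the latter, so that this region is a null set. The countably many regions
  cover the points where the limit is not zero.\<close>

lemma AE_eq_0_if_integrals_0:
  assumes fin: "finite_measure M" and d: "strongly_measurable M d"
    and zero: "\<And>E. E \<in> sets M \<Longrightarrow> has_bochner_int M (\<lambda>x. indicator E x *\<^sub>R d x) 0"
  shows "AE x in M. d x = 0"
proof -
  interpret finite_measure M by fact
  obtain s g where s: "\<And>i::nat. simple_function M (s i)" "\<And>x. (\<lambda>i. s i x) \<longlonglongrightarrow> g x"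
    and dg: "AE x in M. d x = g x"
    using strongly_measurable_representative[OF d] by metis
  define C where "C = (\<Union>i. s i ` space M)"
  have "countable C"
    unfolding C_def by (intro countable_UN countable_finite[OF simple_functionD(1)[OF s(1)]]) simp
  define E where "E c = {x \<in> space M. norm (g x - c) < norm c / 2}" for c
  have null: "E c \<in> null_sets M" for c
  proof (cases "c = 0")
    case False
    have [measurable]: "(\<lambda>x. norm (g x - c)) \<in> borel_measurable M"
      by (rule borel_measurable_norm_limit_diff[OF s]) simp
    have Em[measurable]: "E c \<in> sets M" unfolding E_def by measurable
    have "has_bochner_int M (\<lambda>x. indicator (E c) x *\<^sub>R d x - indicator (E c) x *\<^sub>R c) (0 - measure M (E c) *\<^sub>R c)"
      by (intro has_bochner_int_diff zero Em has_bochner_int_indicator fin)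
    then have "norm (0 - measure M (E c) *\<^sub>R c) \<le> (\<integral>x. norm c / 2 * indicator (E c) x \<partial>M)"
    proof (rule has_bochner_int_norm_bound)
      show "integrable M (\<lambda>x. norm c / 2 * indicator (E c) x)"
        by (intro integrable_mult_right integrable_real_indicator) (auto simp: emeasure_eq_measure)
      show "AE x in M. norm (indicator (E c) x *\<^sub>R d x - indicator (E c) x *\<^sub>R c) \<le> norm c / 2 * indicator (E c) x"
        using dg by eventually_elim (auto simp: E_def indicator_def)
    qed
    then have "measure M (E c) * norm c \<le> norm c / 2 * measure M (E c)"
      by (simp add: Int_absorb1[OF sets.sets_into_space[OF Em]])
    then have "measure M (E c) \<le> 0" using False by (simp add: field_simps)
    then have "measure M (E c) = 0" using measure_nonneg[of M "E c"] by linarith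
    then show ?thesis using Em by (simp add: null_sets_def emeasure_eq_measure)
  qed (simp add: E_def)
  have "(\<Union>c\<in>C. E c) \<in> null_sets M"
    using \<open>countable C\<close> null by (intro null_sets_UN') auto
  from AE_not_in[OF this] dg AE_space show ?thesis
  proof eventually_elim
    case (elim x)
    have "g x = 0"
    proof (rule ccontr)
      assume ne: "g x \<noteq> 0"
      \<comment> \<open>A value within a third of the norm of \<open>g x\<close> has norm at least two thirds of it.\<close>
      then have "norm (g x) / 3 > 0" by simp
      from tendstoD[OF s(2) this] obtain i where "dist (s i x) (g x) < norm (g x) / 3"
        using eventually_happens'[OF sequentially_bot] by blast
      then have "norm (g x - s i x) < norm (s i x) / 2"
        using norm_triangle_ineq[of "g x - s i x" "s i x"] by (simp add: dist_norm norm_minus_commute)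
      then show False using elim by (auto simp: E_def C_def)
    qed
    with elim show ?case by simp
  qed
qed

section \<open>Smooth bump functions\<close>

text \<open>With \<open>R = 1\<close>, \<open>k = 0\<close> and a quadratic polynomial \<open>q\<close> that is positive exactly on an open
  interval, this is the classical bump function of that interval. The parameters \<open>R\<close> and \<open>k\<close> make
  the family closed under differentiation.\<close>

definition flat_extension :: "real poly \<Rightarrow> real \<Rightarrow> real poly \<Rightarrow> nat \<Rightarrow> real \<Rightarrow> real" where
  "flat_extension q c R k x =
    (if poly q x > 0 then poly R x * inverse (poly q x) ^ k * exp (- c / poly q x) else 0)"

lemma power_exp_minus_bound:
  fixes t :: real
  assumes "t \<ge> 0" "m > 0"
  shows "t ^ m * exp (- t) \<le> real m ^ m"
proof -
  have "(t / real m) ^ m \<le> (1 + t / real m) ^ m"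
    using assms by (intro power_mono) auto
  also have "\<dots> \<le> exp t"
    using assms by (intro exp_ge_one_plus_x_over_n_power_n) auto
  finally have "t ^ m \<le> exp t * real m ^ m"
    using assms(2) by (simp add: power_divide field_simps)
  then show ?thesis by (simp add: exp_minus field_simps)
qed

text \<open>The exponential decay outweighs a pole of any order. The factor \<open>u\<^sup>2\<close> that is left over makes
  the flat extension differentiable at the zeros of its polynomial.\<close>

lemma inverse_power_exp_bound:
  fixes u c :: real
  assumes "u > 0" "c > 0"
  shows "inverse u ^ k * exp (- c / u) \<le> (real (k + 2) / c) ^ (k + 2) * u\<^sup>2"
proof -
  have "u\<^sup>2 * (inverse u)\<^sup>2 = 1"
    using assms by (simp flip: power_mult_distrib)
  then have "inverse u ^ k = u\<^sup>2 * inverse u ^ (k + 2)"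
    by (simp only: power_add mult.left_commute[of "u\<^sup>2"] mult_1_right)
  also have "inverse u ^ (k + 2) = inverse c ^ (k + 2) * (c / u) ^ (k + 2)"
    using assms by (simp only: divide_inverse flip: power_mult_distrib) (simp add: mult.assoc[symmetric])
  finally have "inverse u ^ k * exp (- c / u) =
      (inverse c ^ (k + 2) * u\<^sup>2) * ((c / u) ^ (k + 2) * exp (- (c / u)))"
    by (simp only: mult_ac minus_divide_left)
  also have "\<dots> \<le> (inverse c ^ (k + 2) * u\<^sup>2) * real (k + 2) ^ (k + 2)"
    using assms by (intro mult_left_mono power_exp_minus_bound) auto
  also have "\<dots> = (real (k + 2) / c) ^ (k + 2) * u\<^sup>2"
    by (simp only: divide_inverse power_mult_distrib mult_ac)
  finally show ?thesis .
qed

text \<open>Where \<open>q\<close> is positive this is the product rule, and where \<open>q\<close> is negative the function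
  vanishes nearby. At a zero of \<open>q\<close> the function is dominated by a multiple of \<open>R q\<^sup>2\<close>, whose
  derivative there is zero.\<close>

lemma flat_extension_has_derivative:
  assumes c: "c > 0"
  shows "(flat_extension q c R k has_field_derivative
    flat_extension q c (pderiv R * q\<^sup>2 - smult (real k) (R * pderiv q * q) + smult c (R * pderiv q)) (k + 2) x) (at x)"
proof -
  let ?R' = "pderiv R * q\<^sup>2 - smult (real k) (R * pderiv q * q) + smult c (R * pderiv q)"
  have cont: "isCont (poly q) x" by (simp add: poly_isCont)
  consider "poly q x > 0" | "poly q x < 0" | "poly q x = 0" by linarith
  then show ?thesis
  proof cases
    case 1
    let ?i = "inverse (poly q x)"
    have inv: "((\<lambda>y. inverse (poly q y)) has_field_derivative - (poly (pderiv q) x * ?i\<^sup>2)) (at x)"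
      using 1 by (auto intro!: derivative_eq_intros poly_DERIV simp: power2_eq_square)
    have "((\<lambda>y. inverse (poly q y) ^ k) has_field_derivative - (real k * poly (pderiv q) x * ?i ^ (k + 1))) (at x)"
    proof (cases k)
      case (Suc m)
      from DERIV_power_Suc[OF inv, of m] show ?thesis
        unfolding Suc by (simp add: power2_eq_square mult_ac)
    qed simp
    moreover have "((\<lambda>y. exp (- c * inverse (poly q y))) has_field_derivative
        exp (- c * ?i) * (c * poly (pderiv q) x * ?i\<^sup>2)) (at x)"
      using DERIV_fun_exp[OF DERIV_cmult[OF inv, of "- c"]] by (simp add: mult.assoc)
    ultimately have "((\<lambda>y. poly R y * inverse (poly q y) ^ k * exp (- c * inverse (poly q y)))
        has_field_derivative
        (poly (pderiv R) x * ?i ^ k + - (real k * poly (pderiv q) x * ?i ^ (k + 1)) * poly R x)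
            * exp (- c * ?i) +
          exp (- c * ?i) * (c * poly (pderiv q) x * ?i\<^sup>2) * (poly R x * ?i ^ k)) (at x)"
      by (intro DERIV_mult poly_DERIV)
    moreover have "(poly (pderiv R) x * ?i ^ k + - (real k * poly (pderiv q) x * ?i ^ (k + 1)) * poly R x)
            * exp (- c * ?i) +
          exp (- c * ?i) * (c * poly (pderiv q) x * ?i\<^sup>2) * (poly R x * ?i ^ k) =
        flat_extension q c ?R' (k + 2) x"
    proof -
      have ring: "(a * u + - (r * b * v) * d) * e + e * (c * b * w) * (d * u) =
          (a * u - r * b * d * v + c * b * d * (w * u)) * e" for a u r b v d e w :: real
        by (simp add: algebra_simps)
      have "(poly q x)\<^sup>2 * ?i\<^sup>2 = 1" "poly q x * ?i = 1"
        using 1 by (simp_all flip: power_mult_distrib)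
      then have "?i ^ k = (poly q x)\<^sup>2 * ?i ^ (k + 2)" "?i ^ (k + 1) = poly q x * ?i ^ (k + 2)"
        by (simp_all only: power_add power2_eq_square power_one_right mult.left_commute[of "poly q x"]
            mult.left_commute[of "poly q x * poly q x"] mult_1_right)
      moreover have "?i\<^sup>2 * ?i ^ k = ?i ^ (k + 2)" by (simp only: power_add mult.commute)
      moreover have "(poly (pderiv R) x * ?i ^ k + - (real k * poly (pderiv q) x * ?i ^ (k + 1)) * poly R x)
            * exp (- c * ?i) +
          exp (- c * ?i) * (c * poly (pderiv q) x * ?i\<^sup>2) * (poly R x * ?i ^ k) =
          (poly (pderiv R) x * ?i ^ k - real k * poly (pderiv q) x * poly R x * ?i ^ (k + 1)
            + c * poly (pderiv q) x * poly R x * (?i\<^sup>2 * ?i ^ k)) * exp (- c * ?i)"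
        by (rule ring)
      ultimately have "(poly (pderiv R) x * ?i ^ k + - (real k * poly (pderiv q) x * ?i ^ (k + 1)) * poly R x)
            * exp (- c * ?i) +
          exp (- c * ?i) * (c * poly (pderiv q) x * ?i\<^sup>2) * (poly R x * ?i ^ k) =
          (poly (pderiv R) x * ((poly q x)\<^sup>2 * ?i ^ (k + 2))
            - real k * poly (pderiv q) x * poly R x * (poly q x * ?i ^ (k + 2))
            + c * poly (pderiv q) x * poly R x * ?i ^ (k + 2)) * exp (- c * ?i)"
        by metis
      also have "\<dots> = poly ?R' x * ?i ^ (k + 2) * exp (- c * ?i)"
        by (simp del: power_add_numeral power_Suc add: algebra_simps)
      finally show ?thesis
        using 1 by (simp add: flat_extension_def divide_inverse)
    qed
    ultimately have "((\<lambda>y. poly R y * inverse (poly q y) ^ k * exp (- c / poly q y)) has_field_derivative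
        flat_extension q c ?R' (k + 2) x) (at x)"
      by (simp add: divide_inverse)
    moreover have "\<forall>\<^sub>F y in nhds x. flat_extension q c R k y =
        poly R y * inverse (poly q y) ^ k * exp (- c / poly q y)"
      using order_tendstoD(1)[OF isCont_def[THEN iffD1, OF cont] 1] 1
      by (auto simp: eventually_nhds_conv_at flat_extension_def elim: eventually_mono)
    ultimately show ?thesis
      by (rule DERIV_cong_ev[OF refl _ refl, THEN iffD2, rotated])
  next
    case 2
    have "\<forall>\<^sub>F y in nhds x. flat_extension q c R k y = 0"
      using order_tendstoD(2)[OF isCont_def[THEN iffD1, OF cont] 2] 2
      by (auto simp: eventually_nhds_conv_at flat_extension_def elim: eventually_mono)
    from DERIV_cong_ev[OF refl this refl, of 0]
    have "(flat_extension q c R k has_field_derivative 0) (at x)" by simp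
    moreover have "flat_extension q c ?R' (k + 2) x = 0"
      using 2 by (simp add: flat_extension_def)
    ultimately show ?thesis by simp
  next
    case 3
    define K where "K = (real (k + 2) / c) ^ (k + 2)"
    have K: "K \<ge> 0" using c by (simp add: K_def)
    have bound: "\<bar>flat_extension q c R k y\<bar> \<le> K * \<bar>poly R y * (poly q y)\<^sup>2\<bar>" for y
    proof (cases "poly q y > 0")
      case True
      then have "inverse (poly q y) ^ k * exp (- c / poly q y) \<le> K * (poly q y)\<^sup>2"
        unfolding K_def using c by (rule inverse_power_exp_bound)
      then have "\<bar>poly R y\<bar> * (inverse (poly q y) ^ k * exp (- c / poly q y)) \<le>
          \<bar>poly R y\<bar> * (K * (poly q y)\<^sup>2)"
        by (rule mult_left_mono) simp
      then show ?thesis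
        using True by (simp add: flat_extension_def abs_mult mult_ac)
    qed (simp add: flat_extension_def K)
    have "((\<lambda>y. poly R y * (poly q y)\<^sup>2) has_field_derivative 0) (at x)"
      using 3 by (auto intro!: derivative_eq_intros poly_DERIV)
    then have "((\<lambda>y. poly R y * (poly q y)\<^sup>2 / (y - x)) \<longlongrightarrow> 0) (at x)"
      using 3 by (simp add: has_field_derivative_iff)
    then have lim: "((\<lambda>y. K * \<bar>poly R y * (poly q y)\<^sup>2 / (y - x)\<bar>) \<longlongrightarrow> 0) (at x)"
      by (intro tendsto_mult_right_zero tendsto_rabs_zero)
    have "((\<lambda>y. flat_extension q c R k y / (y - x)) \<longlongrightarrow> 0) (at x)"
    proof (rule Lim_null_comparison[OF always_eventually lim], rule allI)
      fix y
      have "\<bar>flat_extension q c R k y\<bar> / \<bar>y - x\<bar> \<le> K * \<bar>poly R y * (poly q y)\<^sup>2\<bar> / \<bar>y - x\<bar>"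
        by (rule divide_right_mono[OF bound]) simp
      then show "norm (flat_extension q c R k y / (y - x)) \<le> K * \<bar>poly R y * (poly q y)\<^sup>2 / (y - x)\<bar>"
        by (simp add: abs_divide)
    qed
    then show ?thesis
      using 3 by (simp add: has_field_derivative_iff flat_extension_def)
  qed
qed

lemma flat_extension_smooth:
  assumes "c > 0"
  shows "((deriv ^^ n) (flat_extension q c R k)) field_differentiable (at x)"
proof -
  have "\<exists>R k. (deriv ^^ n) (flat_extension q c R0 k0) = flat_extension q c R k" for R0 k0
  proof (induction n)
    case (Suc n)
    then obtain R k where "(deriv ^^ n) (flat_extension q c R0 k0) = flat_extension q c R k" by blast
    then have "(deriv ^^ Suc n) (flat_extension q c R0 k0) = deriv (flat_extension q c R k)" by simp
    also have "\<dots> = flat_extension q c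
        (pderiv R * q\<^sup>2 - smult (real k) (R * pderiv q * q) + smult c (R * pderiv q)) (k + 2)"
      by (intro ext DERIV_imp_deriv flat_extension_has_derivative assms)
    finally show ?case by blast
  qed auto
  then obtain R' k' where "(deriv ^^ n) (flat_extension q c R k) = flat_extension q c R' k'" by blast
  then show ?thesis
    using flat_extension_has_derivative[OF assms] unfolding field_differentiable_def by metis
qed

text \<open>The bump functions live on intervals slightly smaller than the given one, which keeps their
  supports inside the open time interval even when \<open>a = 0\<close> or \<open>b = T\<close>; the constant in the exponent
  tends to zero, which drives them to one in the interior.\<close>

lemma indicator_limit_of_test_functions:
  assumes "0 \<le> a" "a < b" "b \<le> T"
  obtains \<phi> where "\<And>n::nat. \<phi> n \<in> test_functions T" "\<And>n x. 0 \<le> \<phi> n x" "\<And>n x. \<phi> n x \<le> 1"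
    "\<And>x. (\<lambda>n. \<phi> n x) \<longlonglongrightarrow> indicator {a<..<b} x"
proof -
  define e where "e n = (b - a) / 3 * inverse (real (Suc n))" for n
  have e: "e n > 0" "a + e n < b - e n" for n
  proof -
    have "(b - a) / 3 * inverse (real (Suc n)) \<le> (b - a) / 3"
      using assms by (intro mult_left_le) (auto simp: inverse_le_1_iff)
    then have "e n \<le> (b - a) / 3" by (simp only: e_def)
    then show "a + e n < b - e n" using assms by argo
    show "e n > 0" using assms by (simp add: e_def)
  qed
  have e0: "e \<longlonglongrightarrow> 0" unfolding e_def by (intro tendsto_mult_right_zero LIMSEQ_inverse_real_of_nat)
  \<comment> \<open>the coefficients of \<open>(x - (a + e n)) * (b - e n - x)\<close>\<close>
  define q where "q n = [:- (a + e n) * (b - e n), a + b, - 1:]" for n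
  have q: "poly (q n) x = (x - (a + e n)) * (b - e n - x)" for n x
    by (simp add: q_def algebra_simps)
  define \<phi> where "\<phi> n = flat_extension (q n) (inverse (real (Suc n))) 1 0" for n
  have pos: "poly (q n) x > 0 \<longleftrightarrow> a + e n < x \<and> x < b - e n" for n x
    using e(2)[of n] by (auto simp: q zero_less_mult_iff)
  show thesis
  proof
    show "\<phi> n \<in> test_functions T" for n
      unfolding test_functions_def mem_Collect_eq
    proof (intro conjI exI[of _ "{a + e n..b - e n}"] allI impI)
      show "((deriv ^^ m) (\<phi> n)) field_differentiable (at t)" for m t
        unfolding \<phi>_def by (rule flat_extension_smooth) simp
      show "{a + e n..b - e n} \<subseteq> {0<..<T}"
        using assms e(1)[of n] by auto
      show "\<phi> n t = 0" if "t \<notin> {a + e n..b - e n}" for t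
        using that pos[of n t] by (auto simp: \<phi>_def flat_extension_def)
    qed simp
    show "0 \<le> \<phi> n x" "\<phi> n x \<le> 1" for n x
      by (auto simp: \<phi>_def flat_extension_def)
    show "(\<lambda>n. \<phi> n x) \<longlonglongrightarrow> indicator {a<..<b} x" for x
    proof (cases "x \<in> {a<..<b}")
      case False
      then have "\<phi> n x = 0" for n
        using pos[of n x] e(1)[of n] by (auto simp: \<phi>_def flat_extension_def)
      then show ?thesis using False by simp
    next
      case True
      have lim: "(\<lambda>n. poly (q n) x) \<longlonglongrightarrow> (x - (a + 0)) * (b - 0 - x)"
        unfolding q by (intro tendsto_intros e0)
      have "(x - (a + 0)) * (b - 0 - x) > 0" using True by simp
      from order_tendstoD(1)[OF lim this]
      have "\<forall>\<^sub>F n in sequentially. exp (- inverse (real (Suc n)) / poly (q n) x) = \<phi> n x"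
        by eventually_elim (simp add: \<phi>_def flat_extension_def)
      moreover have "(\<lambda>n. exp (- inverse (real (Suc n)) / poly (q n) x)) \<longlonglongrightarrow> exp (- 0 / ((x - (a + 0)) * (b - 0 - x)))"
        using True by (intro tendsto_intros lim LIMSEQ_inverse_real_of_nat) auto
      ultimately show ?thesis
        using True Lim_transform_eventually by fastforce
    qed
  qed
qed

section \<open>The fundamental lemma of the calculus of variations\<close>

abbreviation (input) "leb T \<equiv> lebesgue_on {0..T::real}"

lemma finite_measure_leb: "finite_measure (leb T)"
  by (rule finite_measureI) (simp add: emeasure_restrict_space emeasure_lborel_Icc_eq)

lemma Lp1_D:
  assumes "f \<in> Lp 1 T"
  shows "strongly_measurable (leb T) f" "integrable (leb T) (\<lambda>t. norm (f t))"
  using assms by (auto simp: Lp_def)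

lemma continuous_measurable_leb:
  fixes \<phi> :: "real \<Rightarrow> real"
  assumes "continuous_on UNIV \<phi>"
  shows "\<phi> \<in> borel_measurable (leb T)"
  using borel_measurable_continuous_onI[OF assms]
  by (intro measurable_restrict_space1 measurable_completion) simp

lemma test_function_continuous:
  assumes "\<phi> \<in> test_functions T"
  shows "continuous_on UNIV \<phi>" "continuous_on UNIV (deriv \<phi>)"
proof -
  have "((deriv ^^ n) \<phi>) field_differentiable (at t)" for n t
    using assms by (auto simp: test_functions_def)
  from this[of 0] this[of 1] show "continuous_on UNIV \<phi>" "continuous_on UNIV (deriv \<phi>)"
    by (auto intro!: continuous_at_imp_continuous_on field_differentiable_imp_continuous_at)
qed

lemma has_bochner_int_continuous_scaleR:
  fixes f :: "real \<Rightarrow> 'a::banach"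
  assumes \<phi>: "continuous_on UNIV \<phi>" and f: "f \<in> Lp 1 T"
  shows "has_bochner_int (leb T) (\<lambda>t. \<phi> t *\<^sub>R f t) (bochner_int (leb T) (\<lambda>t. \<phi> t *\<^sub>R f t))"
proof -
  have "compact (\<phi> ` {0..T})"
    by (intro compact_continuous_image continuous_on_subset[OF \<phi>]) auto
  then obtain B where "\<forall>y\<in>\<phi> ` {0..T}. norm y \<le> B"
    using compact_imp_bounded bounded_iff by blast
  then have B: "\<bar>\<phi> t\<bar> \<le> B" if "t \<in> {0..T}" for t
    using that by simp
  have "strongly_measurable (leb T) (\<lambda>t. \<phi> t *\<^sub>R f t)"
    by (intro strongly_measurable_scaleR continuous_measurable_leb \<phi> Lp1_D f)
  moreover have "integrable (leb T) (\<lambda>t. B * norm (f t))"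
    by (intro integrable_mult_right Lp1_D f)
  moreover have "AE t in leb T. norm (\<phi> t *\<^sub>R f t) \<le> B * norm (f t)"
    by (rule AE_I2) (auto intro!: mult_right_mono B)
  ultimately obtain a where "has_bochner_int (leb T) (\<lambda>t. \<phi> t *\<^sub>R f t) a"
    by (rule has_bochner_int_exists)
  with bochner_int_eqI[OF this] show ?thesis by simp
qed

text \<open>The fundamental lemma of the calculus of variations. Limits of test functions show that the
  integral vanishes over open intervals. The sets over which it vanishes form a Dynkin system, hence
  contain all Borel sets, and Lebesgue sets differ from these by null sets.\<close>

lemma AE_eq_0_if_test_integrals_0:
  fixes d :: "real \<Rightarrow> 'a::banach"
  assumes T: "T > 0" and d: "d \<in> Lp 1 T"
    and zero: "\<And>\<phi>. \<phi> \<in> test_functions T \<Longrightarrow> bochner_int (leb T) (\<lambda>t. \<phi> t *\<^sub>R d t) = 0"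
  shows "AE t in leb T. d t = 0"
proof -
  note d' = Lp1_D[OF d]
  have ind: "indicator E \<in> borel_measurable (leb T)" if "E \<in> sets borel" for E :: "real set"
    using that by (intro measurable_restrict_space1 measurable_completion) auto
  have ends: "AE t in leb T. t \<in> {0<..<T}"
  proof -
    have "AE t in lebesgue. t \<notin> {0, T}"
      by (rule AE_not_in) auto
    then have "AE t in leb T. t \<notin> {0, T}"
      by (subst AE_restrict_space_iff) (auto elim: eventually_mono)
    then show ?thesis using AE_space by eventually_elim auto
  qed
  define P where "P E \<longleftrightarrow> has_bochner_int (leb T) (\<lambda>t. indicator E t *\<^sub>R d t) 0" for E :: "real set"
  have interval: "P {a<..<b}" if ab: "0 \<le> a" "a < b" "b \<le> T" for a b
  proof -
    obtain \<phi> where \<phi>: "\<And>n::nat. \<phi> n \<in> test_functions T" "\<And>n x. 0 \<le> \<phi> n x" "\<And>n x. \<phi> n x \<le> 1"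
      "\<And>x. (\<lambda>n. \<phi> n x) \<longlonglongrightarrow> indicator {a<..<b} x"
      using indicator_limit_of_test_functions[OF ab] by metis
    show ?thesis unfolding P_def
    proof (rule has_bochner_int_dominated_limit[OF _ _ \<phi>(4) _ d'])
      show "\<phi> n \<in> borel_measurable (leb T)" for n
        by (intro continuous_measurable_leb test_function_continuous(1)[OF \<phi>(1)])
      show "has_bochner_int (leb T) (\<lambda>t. \<phi> n t *\<^sub>R d t) 0" for n
        using has_bochner_int_continuous_scaleR[OF test_function_continuous(1)[OF \<phi>(1)] d, of n]
        by (simp add: zero[OF \<phi>(1)])
      show "indicator {a<..<b} \<in> borel_measurable (leb T)"
        by (intro ind) simp
    qed (use \<phi>(2,3) in \<open>auto simp: abs_le_iff intro: order_trans[of _ 0]\<close>)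
  qed
  have empty: "P {}"
    using has_bochner_int_indicator[OF finite_measure_leb, of "{}" T "0::'a"] by (simp add: P_def)
  have box: "P {a<..<b}" for a b
  proof (cases "max a 0 < min b T")
    case True
    then have "P {max a 0<..<min b T}" by (intro interval) auto
    then show ?thesis unfolding P_def
      by (rule has_bochner_int_cong_AE) (use ends in eventually_elim, auto simp: indicator_def)
  next
    case False
    show ?thesis using empty unfolding P_def
      by (rule has_bochner_int_cong_AE)
        (use ends in eventually_elim, use False in \<open>auto simp: indicator_def\<close>)
  qed
  have univ: "has_bochner_int (leb T) d 0"
  proof (rule has_bochner_int_cong_AE)
    show "has_bochner_int (leb T) (\<lambda>t. indicator {0<..<T} t *\<^sub>R d t) 0"
      using interval[of 0 T] T by (simp add: P_def)
    show "AE t in leb T. indicator {0<..<T} t *\<^sub>R d t = d t"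
      using ends by eventually_elim simp
  qed
  have borel: "P E" if "E \<in> sets borel" for E
  proof -
    let ?G = "range (\<lambda>(a, b). {a<..<b::real})"
    have eq: "sets borel = sigma_sets UNIV ?G"
      by (simp add: borel_eq_box image_def case_prod_unfold)
    have "Int_stable ?G"
      by (auto simp: Int_stable_def)
    moreover have "?G \<subseteq> Pow UNIV" by simp
    moreover from that eq have "E \<in> sigma_sets UNIV ?G" by simp
    ultimately show ?thesis
    proof (induction E rule: sigma_sets_induct_disjoint)
      case (compl A)
      have "has_bochner_int (leb T) (\<lambda>t. d t - indicator A t *\<^sub>R d t) (0 - 0)"
        using compl by (intro has_bochner_int_diff univ) (simp add: P_def)
      then show ?case unfolding P_def
        by (auto elim!: has_bochner_int_cong_AE simp: indicator_def)
    next
      case (union A)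
      have Am: "A i \<in> sets borel" for i using union(2) eq by auto
      have fin: "P (\<Union>i<n. A i)" for n
      proof (induction n)
        case 0 then show ?case using empty by simp
      next
        case (Suc n)
        have "A i \<inter> A n = {}" if "i < n" for i
          using disjoint_family_onD[OF union(1), of i n] that by simp
        then have disj: "(\<Union>i<n. A i) \<inter> A n = {}" by blast
        have "has_bochner_int (leb T) (\<lambda>t. indicator (\<Union>i<n. A i) t *\<^sub>R d t + indicator (A n) t *\<^sub>R d t) (0 + 0)"
          using Suc union(3)[of n] by (intro has_bochner_int_add) (simp_all add: P_def)
        moreover have "indicator (\<Union>i<Suc n. A i) t *\<^sub>R d t =
            indicator (\<Union>i<n. A i) t *\<^sub>R d t + indicator (A n) t *\<^sub>R d t" for t
          using disj by (auto simp: indicator_def lessThan_Suc)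
        ultimately show ?case unfolding P_def by simp
      qed
      show ?case unfolding P_def
      proof (rule has_bochner_int_dominated_limit[OF _ _ LIMSEQ_indicator_UN _ d'])
        show "has_bochner_int (leb T) (\<lambda>t. indicator (\<Union>i<n. A i) t *\<^sub>R d t) 0" for n
          using fin[of n] by (simp add: P_def)
        show "indicator (\<Union>i<n. A i) \<in> borel_measurable (leb T)" for n
          using Am by (intro ind) auto
        show "indicator (\<Union>i. A i) \<in> borel_measurable (leb T)"
          using Am by (intro ind) auto
      qed (simp add: indicator_def)
    qed (use box empty in auto)
  qed
  show ?thesis
  proof (rule AE_eq_0_if_integrals_0[OF finite_measure_leb d'(1)])
    fix E assume "E \<in> sets (leb T)"
    then have "E \<in> sets lebesgue" by (auto simp: sets_restrict_space_iff)
    then obtain S N N' where E: "E = S \<union> N" "N \<subseteq> N'" "N' \<in> null_sets lborel" "S \<in> sets lborel"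
      by (rule sets_completionE)
    have "AE t in lebesgue. t \<notin> N'"
      using E(3) by (intro AE_not_in null_sets_completionI)
    then have "AE t in leb T. t \<notin> N'"
      by (subst AE_restrict_space_iff) (auto elim: eventually_mono)
    then have "AE t in leb T. indicator S t *\<^sub>R d t = indicator E t *\<^sub>R d t"
      by eventually_elim (use E in \<open>auto simp: indicator_def\<close>)
    with borel[of S] E(4) show "has_bochner_int (leb T) (\<lambda>t. indicator E t *\<^sub>R d t) 0"
      unfolding P_def by (auto intro: has_bochner_int_cong_AE)
  qed
qed

section \<open>Integrable functions on an interval\<close>

text \<open>This is where completeness of the Lebesgue measure enters: changing the representative on a
  null set preserves measurability.\<close>

lemma norm_borel_measurable_leb:
  assumes "strongly_measurable (leb T) f"
  shows "(\<lambda>t. norm (f t)) \<in> borel_measurable (leb T)"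
proof -
  obtain g where g: "AE t in leb T. f t = g t"
    and gm: "\<And>s. simple_function (leb T) s \<Longrightarrow> (\<lambda>t. norm (g t - s t)) \<in> borel_measurable (leb T)"
    using strongly_measurable_norm_diff_representative[OF assms] by metis
  have "(\<lambda>t. norm (g t)) \<in> borel_measurable (leb T)"
    using gm[of "\<lambda>_. 0"] by simp
  then have "(\<lambda>t. if t \<in> {0..T} then norm (g t) else 0) \<in> borel_measurable lebesgue"
    by (subst borel_measurable_if) auto
  moreover have "AE t in lebesgue. (if t \<in> {0..T} then norm (g t) else 0) =
      (if t \<in> {0..T} then norm (f t) else 0)"
  proof -
    have "AE t in lebesgue. t \<in> {0..T} \<longrightarrow> f t = g t"
      using g by (simp add: AE_restrict_space_iff)
    then show ?thesis by eventually_elim auto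
  qed
  ultimately have "(\<lambda>t. if t \<in> {0..T} then norm (f t) else 0) \<in> borel_measurable lebesgue"
    by (rule borel_measurable_AE)
  then show ?thesis by (subst (asm) borel_measurable_if) auto
qed

lemma Lp1_I:
  assumes f: "strongly_measurable (leb T) f" and w: "integrable (leb T) w"
    and bd: "\<And>t. t \<in> {0..T} \<Longrightarrow> norm (f t) \<le> w t"
  shows "f \<in> Lp 1 T"
proof -
  have "integrable (leb T) (\<lambda>t. norm (f t))"
    using w norm_borel_measurable_leb[OF f]
  proof (rule Bochner_Integration.integrable_bound)
    show "AE t in leb T. norm (norm (f t)) \<le> norm (w t)"
      by (rule AE_I2) (use bd in \<open>auto intro: order_trans[OF _ abs_ge_self]\<close>)
  qed
  then show ?thesis using f by (simp add: Lp_def)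
qed

lemma Lp1_add:
  assumes "f \<in> Lp 1 T" "g \<in> Lp 1 T"
  shows "(\<lambda>t. f t + g t) \<in> Lp 1 T"
proof (rule Lp1_I)
  show "strongly_measurable (leb T) (\<lambda>t. f t + g t)"
    by (intro strongly_measurable_add Lp1_D assms)
  show "integrable (leb T) (\<lambda>t. norm (f t) + norm (g t))"
    by (intro Bochner_Integration.integrable_add Lp1_D assms)
qed (rule norm_triangle_ineq)

lemma Lp1_bounded_linear:
  assumes "bounded_linear B" "f \<in> Lp 1 T"
  shows "(\<lambda>t. B (f t)) \<in> Lp 1 T"
proof (rule Lp1_I)
  show "strongly_measurable (leb T) (\<lambda>t. B (f t))"
    by (rule strongly_measurable_compose[OF Lp1_D(1)[OF assms(2)] linear_continuous_on[OF assms(1)]])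
  show "integrable (leb T) (\<lambda>t. onorm B * norm (f t))"
    by (intro integrable_mult_right Lp1_D assms)
qed (rule onorm[OF assms(1)])

lemma Lp1_diff:
  fixes f g :: "real \<Rightarrow> 'a::banach"
  assumes "f \<in> Lp 1 T" "g \<in> Lp 1 T"
  shows "(\<lambda>t. f t - g t) \<in> Lp 1 T"
proof -
  have "bounded_linear (\<lambda>x::'a. - x)"
    by (intro bounded_linear_minus bounded_linear_ident)
  from Lp1_add[OF assms(1) Lp1_bounded_linear[OF this assms(2)]] show ?thesis
    by (simp only: add_uminus_conv_diff)
qed

text \<open>On a space of finite measure, \<open>r \<le> 1 + r\<^sup>p\<close> gives integrability.\<close>

lemma Lp_subset_Lp1:
  assumes f: "f \<in> Lp p T" and p: "p \<ge> 1"
  shows "f \<in> Lp 1 T"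
proof (rule Lp1_I)
  interpret finite_measure "leb T" by (rule finite_measure_leb)
  show "strongly_measurable (leb T) f" "integrable (leb T) (\<lambda>t. 1 + norm (f t) powr p)"
    using f by (auto simp: Lp_def)
  show "norm (f t) \<le> 1 + norm (f t) powr p" for t
  proof (cases "norm (f t) \<le> 1")
    case False
    then have "norm (f t) powr 1 \<le> norm (f t) powr p"
      using p by (intro powr_mono) auto
    then show ?thesis by simp
  qed (simp add: add_increasing2)
qed

lemma strongly_measurable_leb_mono:
  assumes f: "strongly_measurable (leb T) f" and t: "t \<le> T"
  shows "strongly_measurable (leb t) f"
proof -
  have eq: "leb t = restrict_space (leb T) {0..t}"
    using t by (subst restrict_restrict_space) (auto simp: Int_absorb1)
  obtain s where s: "\<And>i::nat. simple_function (leb T) (s i)" "AE x in leb T. (\<lambda>i. s i x) \<longlonglongrightarrow> f x"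
    using f by (auto simp: strongly_measurable_def)
  have "simple_function (leb t) (s i)" for i
  proof -
    have "finite (s i ` space (leb T))" "s i \<in> measurable (leb T) (count_space UNIV)"
      using s(1)[of i] by (auto simp: simple_function_eq_measurable)
    then show ?thesis
      unfolding eq simple_function_eq_measurable
      using t by (auto intro!: measurable_restrict_space1 elim!: finite_subset[rotated] simp: space_restrict_space)
  qed
  moreover have "AE x in leb t. (\<lambda>i. s i x) \<longlonglongrightarrow> f x"
    using s(2) t by (auto simp: AE_restrict_space_iff elim!: eventually_mono)
  ultimately show ?thesis unfolding strongly_measurable_def by (intro exI[of _ s] conjI allI)
qed

lemma Lp1_mono:
  assumes "f \<in> Lp 1 T" "t \<le> T"
  shows "f \<in> Lp 1 t"
proof (rule Lp1_I)
  show "strongly_measurable (leb t) f"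
    by (rule strongly_measurable_leb_mono[OF Lp1_D(1)[OF assms(1)] assms(2)])
  show "integrable (leb t) (\<lambda>s. norm (f s))"
    by (rule integrable_subinterval[OF Lp1_D(2)[OF assms(1)]]) (simp add: assms(2))
qed simp

section \<open>The time derivative\<close>

lemma weak_derivative_unique:
  fixes h1 h2 :: "real \<Rightarrow> 'a::banach"
  assumes T: "T > 0" and h: "has_weak_derivative T g h1" "has_weak_derivative T g h2"
  shows "AE t in leb T. h1 t = h2 t"
proof -
  have L: "h1 \<in> Lp 1 T" "h2 \<in> Lp 1 T" using h by (auto simp: has_weak_derivative_def)
  have "AE t in leb T. h1 t - h2 t = 0"
  proof (rule AE_eq_0_if_test_integrals_0[OF T Lp1_diff[OF L]])
    fix \<phi> assume \<phi>: "\<phi> \<in> test_functions T"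
    note c = test_function_continuous(1)[OF \<phi>]
    have "bochner_int (leb T) (\<lambda>t. \<phi> t *\<^sub>R h1 t) = bochner_int (leb T) (\<lambda>t. \<phi> t *\<^sub>R h2 t)"
      using bspec[OF conjunct2[OF conjunct2[OF h(1)[unfolded has_weak_derivative_def]]] \<phi>]
        bspec[OF conjunct2[OF conjunct2[OF h(2)[unfolded has_weak_derivative_def]]] \<phi>]
      by simp
    with has_bochner_int_diff[OF has_bochner_int_continuous_scaleR[OF c L(1)] has_bochner_int_continuous_scaleR[OF c L(2)]]
    show "bochner_int (leb T) (\<lambda>t. \<phi> t *\<^sub>R (h1 t - h2 t)) = 0"
      by (intro bochner_int_eqI) (simp add: scaleR_diff_right)
  qed
  then show ?thesis by simp
qed

lemma has_weak_derivative_add: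
  fixes g1 g2 :: "real \<Rightarrow> 'a::banach"
  assumes "has_weak_derivative T g1 h1" "has_weak_derivative T g2 h2"
  shows "has_weak_derivative T (\<lambda>t. g1 t + g2 t) (\<lambda>t. h1 t + h2 t)"
proof -
  have L: "g1 \<in> Lp 1 T" "h1 \<in> Lp 1 T" "g2 \<in> Lp 1 T" "h2 \<in> Lp 1 T"
    using assms by (auto simp: has_weak_derivative_def)
  have add: "bochner_int (leb T) (\<lambda>t. \<psi> t *\<^sub>R (u t + v t)) =
      bochner_int (leb T) (\<lambda>t. \<psi> t *\<^sub>R u t) + bochner_int (leb T) (\<lambda>t. \<psi> t *\<^sub>R v t)"
    if "continuous_on UNIV \<psi>" "u \<in> Lp 1 T" "v \<in> Lp 1 T" for \<psi> and u v :: "real \<Rightarrow> 'a"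
    using has_bochner_int_add[OF has_bochner_int_continuous_scaleR[OF that(1,2)]
        has_bochner_int_continuous_scaleR[OF that(1,3)]]
    by (intro bochner_int_eqI) (simp add: scaleR_add_right)
  show ?thesis
    unfolding has_weak_derivative_def
  proof (intro conjI ballI Lp1_add L)
    fix \<phi> assume \<phi>: "\<phi> \<in> test_functions T"
    note c = test_function_continuous[OF \<phi>]
    show "bochner_int (leb T) (\<lambda>t. deriv \<phi> t *\<^sub>R (g1 t + g2 t)) =
        - bochner_int (leb T) (\<lambda>t. \<phi> t *\<^sub>R (h1 t + h2 t))"
      using assms \<phi> by (simp add: add[OF c(1) L(2,4)] add[OF c(2) L(1,3)] has_weak_derivative_def)
  qed
qed

lemma W1p_time_deriv:
  assumes "g \<in> W1p p T"
  shows "has_weak_derivative T g (time_deriv T g)"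
proof -
  have "\<exists>h. has_weak_derivative T g h"
    using assms by (auto simp: W1p_def)
  then show ?thesis
    unfolding time_deriv_def by (rule someI_ex)
qed

text \<open>The three time derivatives are chosen independently of each other, so that they
  add up only outside a null set.\<close>

lemma time_deriv_add:
  assumes T: "T > 0" and "g1 \<in> W1p p T" "g2 \<in> W1p p T"
  shows "AE t in leb T. time_deriv T (\<lambda>t. g1 t + g2 t) t = time_deriv T g1 t + time_deriv T g2 t"
    and "has_weak_derivative T (\<lambda>t. g1 t + g2 t) (time_deriv T (\<lambda>t. g1 t + g2 t))"
proof -
  have sum: "has_weak_derivative T (\<lambda>t. g1 t + g2 t) (\<lambda>t. time_deriv T g1 t + time_deriv T g2 t)"
    by (intro has_weak_derivative_add W1p_time_deriv[OF assms(2)] W1p_time_deriv[OF assms(3)])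
  then show "has_weak_derivative T (\<lambda>t. g1 t + g2 t) (time_deriv T (\<lambda>t. g1 t + g2 t))"
    unfolding time_deriv_def[of T "\<lambda>t. g1 t + g2 t"]
    by (rule someI[where P = "has_weak_derivative T (\<lambda>t. g1 t + g2 t)"])
  from weak_derivative_unique[OF T this sum]
  show "AE t in leb T. time_deriv T (\<lambda>t. g1 t + g2 t) t = time_deriv T g1 t + time_deriv T g2 t" .
qed

section \<open>Strongly continuous semigroups\<close>

text \<open>By the category theorem of Baire, one of the sets on which all operators are bounded by a fixed
  number contains a ball. Differences of points of that ball reach every direction.\<close>

lemma uniform_boundedness:
  fixes F :: "'i \<Rightarrow> 'a::banach \<Rightarrow>\<^sub>L 'b::real_normed_vector"
  assumes "\<And>x. bounded ((\<lambda>i. blinfun_apply (F i) x) ` I)"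
  obtains C where "\<And>i. i \<in> I \<Longrightarrow> norm (F i) \<le> C"
proof -
  define G where "G n = {x. \<forall>i\<in>I. norm (blinfun_apply (F i) x) \<le> real n}" for n :: nat
  have closed: "closed (G n)" for n
  proof -
    have "G n = (\<Inter>i\<in>I. {x. norm (blinfun_apply (F i) x) \<le> real n})" by (auto simp: G_def)
    also have "closed \<dots>" by (intro closed_INT ballI closed_Collect_le continuous_intros)
    finally show ?thesis .
  qed
  have cover: "x \<in> (\<Union>n. G n)" for x
  proof -
    obtain B where B: "\<forall>y\<in>(\<lambda>i. blinfun_apply (F i) x) ` I. norm y \<le> B"
      using assms[of x] unfolding bounded_iff by blast
    obtain n where "B \<le> real n" using real_arch_simple by blast
    with B have "x \<in> G n" by (fastforce simp: G_def)
    then show ?thesis by blast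
  qed
  have "\<exists>n. interior (G n) \<noteq> {}"
  proof (rule ccontr)
    assume "\<nexists>n. interior (G n) \<noteq> {}"
    then have "Met_TC.mtopology interior_of \<Union>(range G) = {}"
      using closed by (intro Met_TC.metric_Baire_category_alt) (auto simp: complete_UNIV)
    moreover have "\<Union>(range G) = UNIV" using cover by blast
    ultimately show False by simp
  qed
  then obtain n x0 r where r: "r > 0" "cball x0 r \<subseteq> G n"
    using mem_interior_cball by blast
  have "norm (F i) \<le> 2 * real n / r" if i: "i \<in> I" for i
  proof (rule norm_blinfun_bound)
    fix x :: 'a
    show "norm (blinfun_apply (F i) x) \<le> 2 * real n / r * norm x"
    proof (cases "x = 0")
      case False
      define y where "y = x0 + (r / norm x) *\<^sub>R x"
      have "y \<in> cball x0 r" "x0 \<in> cball x0 r" using r(1) False by (simp_all add: y_def dist_norm)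
      with r(2) have "y \<in> G n" "x0 \<in> G n" by auto
      then have "norm (blinfun_apply (F i) y - blinfun_apply (F i) x0) \<le> real n + real n"
        using i by (intro norm_triangle_le_diff add_mono) (simp_all add: G_def)
      also have "blinfun_apply (F i) y - blinfun_apply (F i) x0 = (r / norm x) *\<^sub>R blinfun_apply (F i) x"
        by (simp add: y_def blinfun.add_right blinfun.scaleR_right)
      finally show ?thesis using r False by (simp add: field_simps)
    qed simp
  qed (use r in simp)
  then show thesis by (rule that)
qed

text \<open>Orbits are continuous, hence bounded on a compact interval.\<close>

lemma C0_semigroup_bounded:
  fixes S :: "real \<Rightarrow> 'a::banach \<Rightarrow>\<^sub>L 'a"
  assumes "C0_semigroup S"
  obtains M where "M \<ge> 1" "\<And>t. t \<in> {0..T} \<Longrightarrow> norm (S t) \<le> M"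
proof -
  have "bounded ((\<lambda>t. blinfun_apply (S t) x) ` {0..T})" for x
    using assms unfolding C0_semigroup_def
    by (intro compact_imp_bounded compact_continuous_image) (auto intro: continuous_on_subset)
  from uniform_boundedness[of S "{0..T}", OF this]
  obtain C where "\<And>t. t \<in> {0..T} \<Longrightarrow> norm (S t) \<le> C" by blast
  then show thesis by (intro that[of "max 1 C"]) (simp_all add: le_max_iff_disj)
qed

text \<open>Rounding the time variable down to a grid of mesh \<open>1 / (n + 1)\<close> turns the operator family into
  one with finitely many members, so that its application to a simple function is simple again.
  Rounding down keeps the time variable in the interval. Convergence follows from the uniform bound
  and from strong continuity.\<close>

lemma strongly_measurable_operator_apply:
  fixes V :: "real \<Rightarrow> 'a::real_normed_vector \<Rightarrow>\<^sub>L 'b::real_normed_vector"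
  assumes cont: "\<And>x. continuous_on {0..t} (\<lambda>s. blinfun_apply (V s) x)"
    and bd: "\<And>s. s \<in> {0..t} \<Longrightarrow> norm (V s) \<le> M"
    and f: "strongly_measurable (leb t) f"
  shows "strongly_measurable (leb t) (\<lambda>s. blinfun_apply (V s) (f s))"
proof -
  obtain \<sigma> where \<sigma>: "\<And>n::nat. simple_function (leb t) (\<sigma> n)" "AE s in leb t. (\<lambda>n. \<sigma> n s) \<longlonglongrightarrow> f s"
    using f by (auto simp: strongly_measurable_def)
  define r where "r n s = of_int \<lfloor>real (Suc n) * s\<rfloor> / real (Suc n)" for n :: nat and s
  have r_simple: "simple_function (leb t) (r n)" for n
  proof (rule simple_function_borel_measurable)
    have "r n \<in> borel_measurable borel" unfolding r_def by measurable
    then show "r n \<in> borel_measurable (leb t)"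
      by (intro measurable_restrict_space1 measurable_completion) simp
    have "r n ` space (leb t) \<subseteq> (\<lambda>k. of_int k / real (Suc n)) ` {0..\<lfloor>real (Suc n) * t\<rfloor>}"
      by (auto simp: r_def intro!: imageI floor_mono mult_left_mono)
    then show "finite (r n ` space (leb t))" by (rule finite_subset) simp
  qed
  have r_mem: "r n s \<in> {0..t}" if "s \<in> {0..t}" for n s
  proof -
    have "r n s \<le> s" using of_int_floor_le[of "real (Suc n) * s"] by (simp add: r_def field_simps)
    moreover have "0 \<le> r n s" using that by (simp add: r_def)
    ultimately show ?thesis using that by auto
  qed
  have r_lim: "(\<lambda>n. r n s) \<longlonglongrightarrow> s" for s
  proof (rule tendsto_sandwich)
    have "s - inverse (real (Suc n)) \<le> r n s" for n
    proof -
      have "real (Suc n) * s - 1 \<le> of_int \<lfloor>real (Suc n) * s\<rfloor>" by linarith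
      then have "(real (Suc n) * s - 1) / real (Suc n) \<le> r n s"
        unfolding r_def by (rule divide_right_mono) simp
      moreover have "(real (Suc n) * s - 1) / real (Suc n) = s - inverse (real (Suc n))"
        by (simp add: divide_simps)
      ultimately show ?thesis by simp
    qed
    then show "\<forall>\<^sub>F n in sequentially. s - inverse (real (Suc n)) \<le> r n s" by simp
    have "r n s \<le> s" for n
      using of_int_floor_le[of "real (Suc n) * s"] by (simp add: r_def field_simps)
    then show "\<forall>\<^sub>F n in sequentially. r n s \<le> s" by simp
    show "(\<lambda>n. s - inverse (real (Suc n))) \<longlonglongrightarrow> s"
      using tendsto_diff[OF tendsto_const LIMSEQ_inverse_real_of_nat] by simp
  qed simp
  have "AE s in leb t. (\<lambda>n. blinfun_apply (V (r n s)) (\<sigma> n s)) \<longlonglongrightarrow> blinfun_apply (V s) (f s)"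
    using \<sigma>(2) AE_space
  proof eventually_elim
    case (elim s)
    then have s: "s \<in> {0..t}" by simp
    have "(\<lambda>n. blinfun_apply (V (r n s)) (\<sigma> n s - f s)) \<longlonglongrightarrow> 0"
    proof (rule Lim_null_comparison[OF always_eventually], rule allI)
      show "norm (blinfun_apply (V (r n s)) (\<sigma> n s - f s)) \<le> M * norm (\<sigma> n s - f s)" for n
        by (rule order_trans[OF norm_blinfun mult_right_mono[OF bd[OF r_mem[OF s]]]]) simp
      show "(\<lambda>n. M * norm (\<sigma> n s - f s)) \<longlonglongrightarrow> 0"
        using elim(1) by (intro tendsto_mult_right_zero) (simp add: tendsto_norm_zero_iff LIM_zero_iff)
    qed
    moreover have "\<forall>n. r n s \<in> {0..t}" using r_mem[OF s] by blast
    then have "\<forall>\<^sub>F n in sequentially. r n s \<in> {0..t}" by (rule always_eventually)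
    then have "(\<lambda>n. blinfun_apply (V (r n s)) (f s)) \<longlonglongrightarrow> blinfun_apply (V s) (f s)"
      by (rule continuous_on_tendsto_compose[OF cont[of "f s"] r_lim s])
    ultimately have "(\<lambda>n. blinfun_apply (V (r n s)) (\<sigma> n s - f s) + blinfun_apply (V (r n s)) (f s))
        \<longlonglongrightarrow> 0 + blinfun_apply (V s) (f s)"
      by (rule tendsto_add)
    then show ?case by (simp add: blinfun.diff_right)
  qed
  moreover have "simple_function (leb t) (\<lambda>s. blinfun_apply (V (r n s)) (\<sigma> n s))" for n
    by (rule simple_function_compose2[OF r_simple \<sigma>(1), of "\<lambda>r. blinfun_apply (V r)"])
  ultimately show ?thesis
    unfolding strongly_measurable_def
    by (intro exI[of _ "\<lambda>n s. blinfun_apply (V (r n s)) (\<sigma> n s)"] conjI allI)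
qed

lemma has_bochner_int_semigroup_convolution:
  fixes S :: "real \<Rightarrow> 'a::banach \<Rightarrow>\<^sub>L 'a"
  assumes S: "C0_semigroup S" and t: "t \<ge> 0" and h: "h \<in> Lp 1 t"
  shows "has_bochner_int (leb t) (\<lambda>s. blinfun_apply (S (t - s)) (h s))
    (bochner_int (leb t) (\<lambda>s. blinfun_apply (S (t - s)) (h s)))"
proof -
  obtain M where M: "\<And>s. s \<in> {0..t} \<Longrightarrow> norm (S s) \<le> M"
    using C0_semigroup_bounded[OF S] by blast
  then have M': "norm (S (t - s)) \<le> M" if "s \<in> {0..t}" for s using that by auto
  have "strongly_measurable (leb t) (\<lambda>s. blinfun_apply (S (t - s)) (h s))"
  proof (rule strongly_measurable_operator_apply[OF _ M' Lp1_D(1)[OF h]])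
    have "continuous_on {0..} (\<lambda>s. blinfun_apply (S s) x)" for x
      using S by (simp add: C0_semigroup_def)
    then show "continuous_on {0..t} (\<lambda>s. blinfun_apply (S (t - s)) x)" for x
      by (rule continuous_on_compose2) (auto intro!: continuous_intros)
  qed
  moreover have "integrable (leb t) (\<lambda>s. M * norm (h s))"
    by (intro integrable_mult_right Lp1_D h)
  moreover have "AE s in leb t. norm (blinfun_apply (S (t - s)) (h s)) \<le> M * norm (h s)"
    by (rule AE_I2) (auto intro!: order_trans[OF norm_blinfun] mult_right_mono M')
  ultimately obtain a where "has_bochner_int (leb t) (\<lambda>s. blinfun_apply (S (t - s)) (h s)) a"
    by (rule has_bochner_int_exists)
  with bochner_int_eqI[OF this] show ?thesis by simp
qed

section \<open>The stability estimate\<close>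

lemma bounded_into_graph_bounded_linear:
  assumes A: "linear_operator X A" and B: "bounded_into_graph X A B"
  shows "bounded_linear B" "bounded_linear (\<lambda>u. A (B u))"
proof -
  obtain C where lin: "linear B" and ran: "\<And>u. B u \<in> X" and C: "\<And>u. norm (B u) + norm (A (B u)) \<le> C * norm u"
    using B by (auto simp: bounded_into_graph_def graph_norm_def)
  interpret linear B by fact
  show "bounded_linear B"
  proof (rule bounded_linear_intro)
    show "norm (B u) \<le> norm u * C" for u
      using C[of u] norm_ge_zero[of "A (B u)"] unfolding mult.commute[of "norm u"] by linarith
  qed (simp_all add: add scaleR)
  show "bounded_linear (\<lambda>u. A (B u))"
  proof (rule bounded_linear_intro)
    show "norm (A (B u)) \<le> norm u * C" for u
      using C[of u] norm_ge_zero[of "B u"] unfolding mult.commute[of "norm u"] by linarith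
  qed (use A ran in \<open>simp_all add: add scaleR linear_operator_def\<close>)
qed

theorem theorem3p1:
  fixes T p :: real
    and dom_A dom_D :: "'z::banach set"
    and A :: "'z \<Rightarrow> 'z"
    and D :: "'z \<Rightarrow> 'u::banach"
    and D0 :: "'u \<Rightarrow> 'z"
    and S :: "real \<Rightarrow> 'z \<Rightarrow>\<^sub>L 'z"
    and z0 \<delta>0 :: 'z
    and zb \<delta>b :: "real \<Rightarrow> 'u"
    and \<delta> z z' :: "real \<Rightarrow> 'z"
  assumes "T > 0"
    and "linear_operator dom_A A"
    and "linear_operator dom_D D"
    and "dom_A \<subseteq> dom_D"
    and "C0_semigroup S"
    and "is_generator (dom_A \<inter> ker_op dom_D D) A S"
    and "bounded_into_graph dom_A A D0"
    and "\<And>u. D (D0 u) = u"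
    and "p \<ge> 1"
    and "zb \<in> W1p p T"
    and "\<delta>b \<in> W1p p T"
    and "\<delta> \<in> Lp p T"
    and "\<And>t. t \<in> {0..T} \<Longrightarrow> z t = mild_solution T S A D0 (\<lambda>s. 0) zb z0 t"
    and "\<And>t. t \<in> {0..T} \<Longrightarrow>
           z' t = mild_solution T S A D0 \<delta> (\<lambda>s. zb s + \<delta>b s) (z0 + \<delta>0) t"
  shows "\<exists>M \<omega> :: real. M \<ge> 1 \<and> (\<forall>t\<in>{0..T}.
    norm (z t - z' t) \<le>
      onorm D0 * norm (\<delta>b t) + M * exp (\<omega> * t) * norm (\<delta>0 - D0 (\<delta>b 0)) +
      (\<integral>s. M * exp (\<omega> * (t - s)) *
         (onorm (\<lambda>u. A (D0 u)) * norm (\<delta>b s) + onorm D0 * norm (time_deriv T \<delta>b s) + norm (\<delta> s))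
       \<partial>lebesgue_on {0..t}))"
proof -
  note S = \<open>C0_semigroup S\<close>
  note lin = bounded_into_graph_bounded_linear[OF assms(2,7)]
  interpret D0: bounded_linear D0 by (rule lin)
  interpret AD0: bounded_linear "\<lambda>u. A (D0 u)" by (rule lin)
  let ?zd = "time_deriv T zb" and ?dd = "time_deriv T \<delta>b" and ?sd = "time_deriv T (\<lambda>s. zb s + \<delta>b s)"
  note sum_deriv = time_deriv_add[OF assms(1,10,11)]
  have L: "zb \<in> Lp 1 T" "?zd \<in> Lp 1 T" "\<delta>b \<in> Lp 1 T" "?dd \<in> Lp 1 T" "?sd \<in> Lp 1 T" "\<delta> \<in> Lp 1 T"
    using W1p_time_deriv[OF assms(10)] W1p_time_deriv[OF assms(11)] sum_deriv(2)
      Lp_subset_Lp1[OF assms(12,9)]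
    by (auto simp: has_weak_derivative_def)
  define h where "h s = 0 - D0 (?zd s) + A (D0 (zb s))" for s
  define h' where "h' s = \<delta> s - D0 (?sd s) + A (D0 (zb s + \<delta>b s))" for s
  define W where "W s = onorm (\<lambda>u. A (D0 u)) * norm (\<delta>b s) + onorm D0 * norm (?dd s) + norm (\<delta> s)" for s
  have hL: "h \<in> Lp 1 T"
    using Lp1_diff[OF Lp1_bounded_linear[OF lin(2) L(1)] Lp1_bounded_linear[OF lin(1) L(2)]]
    by (simp add: h_def[abs_def])
  have h'L: "h' \<in> Lp 1 T"
    unfolding h'_def[abs_def]
    by (intro Lp1_add Lp1_diff L Lp1_bounded_linear[OF lin(1)] Lp1_bounded_linear[OF lin(2)])
  have WL: "integrable (leb T) W"
    unfolding W_def[abs_def]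
    by (intro Bochner_Integration.integrable_add integrable_mult_right Lp1_D L)
  have diff_bound: "AE s in leb T. norm (h s - h' s) \<le> W s"
    using sum_deriv(1)
  proof eventually_elim
    case (elim s)
    have "h s - h' s = D0 (?dd s) - A (D0 (\<delta>b s)) - \<delta> s"
      by (simp add: h_def h'_def elim D0.add[of "?zd s"] AD0.add)
    also have "norm \<dots> \<le> norm (D0 (?dd s)) + norm (A (D0 (\<delta>b s))) + norm (\<delta> s)"
      by (meson norm_triangle_ineq4 add_right_mono order_trans)
    also have "\<dots> \<le> W s"
      using onorm[OF lin(1), of "?dd s"] onorm[OF lin(2), of "\<delta>b s"] by (simp add: W_def)
    finally show ?case .
  qed
  obtain M where M: "M \<ge> 1" "\<And>t. t \<in> {0..T} \<Longrightarrow> norm (S t) \<le> M"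
    using C0_semigroup_bounded[OF S] by blast
  \<comment> \<open>A uniform bound on the time interval is an exponential bound with rate zero.\<close>
  have "norm (z t - z' t) \<le> onorm D0 * norm (\<delta>b t) + M * exp (0 * t) * norm (\<delta>0 - D0 (\<delta>b 0)) +
      (\<integral>s. M * exp (0 * (t - s)) * W s \<partial>leb t)" if t: "t \<in> {0..T}" for t
  proof -
    let ?I = "bochner_int (leb t) (\<lambda>s. blinfun_apply (S (t - s)) (h s))"
    let ?I' = "bochner_int (leb t) (\<lambda>s. blinfun_apply (S (t - s)) (h' s))"
    have "norm (?I - ?I') \<le> (\<integral>s. M * W s \<partial>leb t)"
    proof (rule has_bochner_int_norm_bound)
      show "has_bochner_int (leb t) (\<lambda>s. blinfun_apply (S (t - s)) (h s) - blinfun_apply (S (t - s)) (h' s)) (?I - ?I')"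
        using t by (intro has_bochner_int_diff has_bochner_int_semigroup_convolution S
            Lp1_mono[OF hL] Lp1_mono[OF h'L]) auto
      show "integrable (leb t) (\<lambda>s. M * W s)"
        using t by (intro integrable_mult_right integrable_subinterval[OF WL]) auto
      have "AE s in leb t. norm (h s - h' s) \<le> W s"
        using diff_bound t by (auto simp: AE_restrict_space_iff elim!: eventually_mono)
      then show "AE s in leb t. norm (blinfun_apply (S (t - s)) (h s) - blinfun_apply (S (t - s)) (h' s)) \<le> M * W s"
        using AE_space
      proof eventually_elim
        case (elim s)
        have "norm (blinfun_apply (S (t - s)) (h s - h' s)) \<le> norm (S (t - s)) * norm (h s - h' s)"
          by (rule norm_blinfun)
        also have "\<dots> \<le> M * W s"
          using elim t M by (intro mult_mono) auto
        finally show ?case by (simp add: blinfun.diff_right)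
      qed
    qed
    moreover have "norm (D0 (\<delta>b t)) \<le> onorm D0 * norm (\<delta>b t)"
      by (rule onorm[OF lin(1)])
    moreover have "norm (blinfun_apply (S t) (\<delta>0 - D0 (\<delta>b 0))) \<le> M * norm (\<delta>0 - D0 (\<delta>b 0))"
      by (rule order_trans[OF norm_blinfun mult_right_mono[OF M(2)[OF t]]]) simp
    moreover have "z t - z' t = - D0 (\<delta>b t) - blinfun_apply (S t) (\<delta>0 - D0 (\<delta>b 0)) + (?I - ?I')"
      using assms(13)[OF t] assms(14)[OF t]
      by (simp add: mild_solution_def h_def h'_def D0.add blinfun.add_right blinfun.diff_right)
    ultimately show ?thesis
      using norm_triangle_ineq[of "- D0 (\<delta>b t) - blinfun_apply (S t) (\<delta>0 - D0 (\<delta>b 0))" "?I - ?I'"]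
        norm_triangle_ineq4[of "- D0 (\<delta>b t)" "blinfun_apply (S t) (\<delta>0 - D0 (\<delta>b 0))"]
      by simp
  qed
  then show ?thesis
    using M(1) unfolding W_def by blast
qed

end
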